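(* Assume that the partial derivatives $\partial_x^\alpha\mathbf u$ with $|\alpha|\le3$ and the mixed partial derivatives $\partial_t\partial_x^\beta\mathbf u$ with $|\beta|\le2$, defined on $\mathcal D\times\mathbb R^+$, are uniformly bounded and uniformly Lipschitz continuous. Let $L_M>0$ be a constant with $\|\mathbf M_{\mathbf u}\|_\infty\le L_M$ and assume $\epsilon<1/L_M$. Then the Maxey--Riley equation has unique, continuous, global mild solutions: for any $(\mathbf y_0,\mathbf w_0)\in\mathbb R^{2n}$ there exists a unique continuous function $(\mathbf y,\mathbf w):[0,\infty)\to\mathbb R^{2n}$ with $(\mathbf y(0),\mathbf w(0))=(\mathbf y_0,\mathbf w_0)$ satisfying, for all $\tau\ge0$, $$\mathbf y(\tau)=\mathbf y_0+\epsilon\int_0^\tau\left[\mathbf w(s)+\mathbf A_{\mathbf u}(\mathbf y(s),s)\right]ds,$$ $$\mathbf w(\tau)=\psi(\tau)\mathbf w_0+\epsilon\int_0^\tau\psi(\tau-s)\left[-\mathbf M_{\mathbf u}(\mathbf y(s),s)\mathbf w(s)+\mathbf B_{\mathbf u}(\mathbf y(s),s)\right]ds.$$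
   Context: Data: $n\in\{2,3\}$; $\mathbb R^+=[0,\infty)$; $\mathcal D\subseteq\mathbb R^n$ is an open spatial domain; $\mathbf u:\mathcal D\times\mathbb R^+\to\mathbb R^n$ is a given (dimensionless) fluid velocity field; $t_0\in\mathbb R^+$; $\mathbf g\in\mathbb R^n$ is a constant vector. Parameters: $R=2\rho_f/(\rho_f+2\rho_p)$ with $\rho_f,\rho_p>0$, $\kappa=\sqrt{9R/2}$, $\gamma=9R/(2\mathrm{Re})$ with $\mathrm{Re}>0$, and $\epsilon>0$. With $\frac{D}{Dt}=\partial_t+\mathbf u\cdot\nabla$, define on $\mathcal D\times\mathbb R^+$ $$\mathbf A_{\mathbf u}=\mathbf u+\tfrac{\gamma\epsilon}{6}\Delta\mathbf u,\qquad \mathbf M_{\mathbf u}=\nabla\mathbf u+\tfrac{\gamma\epsilon}{6}\nabla\Delta\mathbf u,$$ $$\mathbf B_{\mathbf u}=\left(\tfrac{3R}{2}-1\right)\left(\tfrac{D\mathbf u}{Dt}-\mathbf g\right)+\left(\tfrac{R}{20}-\tfrac16\right)\gamma\epsilon\tfrac{D}{Dt}\Delta\mathbf u-\tfrac{\gamma\epsilon}{6}\left[\nabla\mathbf u+\tfrac{\gamma\epsilon}{6}\nabla\Delta\mathbf u\right]\Delta\mathbf u .$$ In terms of the rescaled time $\tau$ (with $t=t_0+\epsilon\tau$), the symbols $\mathbf A_{\mathbf u}(\mathbf y,\tau),\mathbf B_{\mathbf u}(\mathbf y,\tau),\mathbf M_{\mathbf u}(\mathbf y,\tau)$ in the integral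 equations stand for the fields $\mathbf A_{\mathbf u},\mathbf B_{\mathbf u},\mathbf M_{\mathbf u}$, respectively, evaluated at $(\mathbf y,t_0+\epsilon\tau)$. $|\cdot|$ is the Euclidean norm, $\|\cdot\|$ the induced operator norm of matrices, and $\|\mathbf M_{\mathbf u}\|_\infty$ the supremum of $\|\mathbf M_{\mathbf u}\|$ over $\mathcal D\times\mathbb R^+$. The function $\psi:[0,\infty)\to\mathbb R$ is the continuous function whose Laplace transform is $\frac{1}{s+\kappa\sqrt s+1}$. The integral equations are the mild form of the rescaled Maxey--Riley equation $\frac{d\mathbf y}{d\tau}=\epsilon[\mathbf w+\mathbf A_{\mathbf u}(\mathbf y,\tau)]$, $\frac{d\mathbf w}{d\tau}+\kappa\frac{d^{1/2}\mathbf w}{d\tau^{1/2}}+\mathbf w=\epsilon[-\mathbf M_{\mathbf u}(\mathbf y,\tau)\mathbf w+\mathbf B_{\mathbf u}(\mathbf y,\tau)]$, where $\frac{d^{1/2}\mathbf w}{d\tau^{1/2}}=\frac{d}{d\tau}\left(\frac1{\sqrt\pi}\int_0^\tau\frac{\mathbf w(s)}{\sqrt{\tau-s}}ds\right)$.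
   Formalization: For D other than R^n the claim fails (constant u carries a particle out of a ball), so solutions must stay in D and (y0,w0) is any initial datum whose trajectory, as long as it lies in D before a time T, is in D at T (so y0 lies in D); for D = R^n all (y0,w0) are covered. *)

theory Defs
  imports "HOL-Analysis.Analysis"
begin

text \<open>
  Time-dependent vector fields are curried functions of position and time. Only their values at
  positions in the open domain and at times \<open>t \<ge> 0\<close> matter, and therefore the time derivative at
  \<open>t = 0\<close> is one-sided.
\<close>

type_synonym 'n field = "real ^ 'n \<Rightarrow> real \<Rightarrow> real ^ 'n"

definition partial_x :: "'n::finite \<Rightarrow> 'n field \<Rightarrow> 'n field" where
  "partial_x i f x t = vector_derivative (\<lambda>h. f (x + h *\<^sub>R axis i 1) t) (at 0)"

definition partial_t :: "'n::finite field \<Rightarrow> 'n field" where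
  "partial_t f x t = vector_derivative (f x) (at t within {0..})"

text \<open>
  A multi-index of order \<open>k\<close> is represented by a list of \<open>k\<close> coordinate directions;
  \<open>partials_x [i, j] f\<close> is the iterated derivative \<open>partial_x i (partial_x j f)\<close>.
\<close>

definition partials_x :: "'n::finite list \<Rightarrow> 'n field \<Rightarrow> 'n field" where
  "partials_x is f = foldr partial_x is f"

definition partial_x_exists :: "(real ^ 'n) set \<Rightarrow> 'n::finite \<Rightarrow> 'n field \<Rightarrow> bool" where
  "partial_x_exists D i f \<longleftrightarrow>
     (\<forall>x\<in>D. \<forall>t\<ge>0. (\<lambda>h. f (x + h *\<^sub>R axis i 1) t) differentiable (at 0))"

definition partial_t_exists :: "(real ^ 'n) set \<Rightarrow> 'n::finite field \<Rightarrow> bool" where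
  "partial_t_exists D f \<longleftrightarrow> (\<forall>x\<in>D. \<forall>t\<ge>0. f x differentiable (at t within {0..}))"

definition bounded_lipschitz :: "(real ^ 'n) set \<Rightarrow> 'n::finite field \<Rightarrow> bool" where
  "bounded_lipschitz D f \<longleftrightarrow>
     bounded ((\<lambda>(x, t). f x t) ` (D \<times> {0..})) \<and>
     (\<exists>L. L-lipschitz_on (D \<times> {0..}) (\<lambda>(x, t). f x t))"

definition regular_velocity :: "(real ^ 'n) set \<Rightarrow> 'n::finite field \<Rightarrow> bool" where
  "regular_velocity D u \<longleftrightarrow>
     (\<forall>is i. length is \<le> 2 \<longrightarrow> partial_x_exists D i (partials_x is u)) \<and>
     (\<forall>is. length is \<le> 3 \<longrightarrow> bounded_lipschitz D (partials_x is u)) \<and>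
     (\<forall>is. length is \<le> 2 \<longrightarrow>
        partial_t_exists D (partials_x is u) \<and>
        bounded_lipschitz D (partial_t (partials_x is u)))"

definition grad :: "'n::finite field \<Rightarrow> real ^ 'n \<Rightarrow> real \<Rightarrow> real ^ 'n ^ 'n" where
  "grad f x t = (\<chi> i j. partial_x j f x t $ i)"

definition laplacian :: "'n::finite field \<Rightarrow> 'n field" where
  "laplacian f x t = (\<Sum>i\<in>UNIV. partial_x i (partial_x i f) x t)"

text \<open>The derivative \<open>D/Dt = \<partial>\<^sub>t + u \<cdot> \<nabla>\<close>, where \<open>(u \<cdot> \<nabla>) f = (\<nabla>f) u\<close>.\<close>

definition material_derivative :: "'n::finite field \<Rightarrow> 'n field \<Rightarrow> 'n field" where
  "material_derivative u f x t = partial_t f x t + grad f x t *v u x t"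

definition A_field :: "real \<Rightarrow> real \<Rightarrow> 'n::finite field \<Rightarrow> 'n field" where
  "A_field \<gamma> \<epsilon> u x t = u x t + (\<gamma> * \<epsilon> / 6) *\<^sub>R laplacian u x t"

definition M_field ::
  "real \<Rightarrow> real \<Rightarrow> 'n::finite field \<Rightarrow> real ^ 'n \<Rightarrow> real \<Rightarrow> real ^ 'n ^ 'n" where
  "M_field \<gamma> \<epsilon> u x t = grad u x t + (\<gamma> * \<epsilon> / 6) *\<^sub>R grad (laplacian u) x t"

definition B_field ::
  "real \<Rightarrow> real \<Rightarrow> real \<Rightarrow> real ^ 'n \<Rightarrow> 'n::finite field \<Rightarrow> 'n field" where
  "B_field R \<gamma> \<epsilon> g u x t =
     (3 * R / 2 - 1) *\<^sub>R (material_derivative u u x t - g)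
     + ((R / 20 - 1 / 6) * \<gamma> * \<epsilon>) *\<^sub>R material_derivative u (laplacian u) x t
     - (\<gamma> * \<epsilon> / 6) *\<^sub>R
         ((grad u x t + (\<gamma> * \<epsilon> / 6) *\<^sub>R grad (laplacian u) x t) *v laplacian u x t)"

text \<open>The supremum is taken in the extended reals, so it is \<open>\<infinity>\<close> for an unbounded matrix field.\<close>

definition sup_onorm ::
  "(real ^ 'n) set \<Rightarrow> (real ^ 'n \<Rightarrow> real \<Rightarrow> real ^ 'n ^ 'n::finite) \<Rightarrow> ereal" where
  "sup_onorm D M = (SUP (x, t)\<in>D \<times> {0..}. ereal (onorm (\<lambda>v. M x t *v v)))"

text \<open>Laplace transform on the right half-plane, as an absolutely convergent integral.\<close>

definition has_laplace_transform :: "(real \<Rightarrow> real) \<Rightarrow> (complex \<Rightarrow> complex) \<Rightarrow> bool" where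
  "has_laplace_transform f F \<longleftrightarrow>
     (\<forall>s. Re s > 0 \<longrightarrow>
        set_integrable lborel {0..} (\<lambda>t. exp (- s * of_real t) * of_real (f t)) \<and>
        set_lebesgue_integral lborel {0..} (\<lambda>t. exp (- s * of_real t) * of_real (f t)) = F s)"

text \<open>The integral equations on a time interval \<open>I\<close> starting at \<open>0\<close>; the field \<open>B\<close> includes gravity.\<close>

definition mild_equations ::
  "real set \<Rightarrow> real \<Rightarrow> real \<Rightarrow> (real \<Rightarrow> real) \<Rightarrow> 'n::finite field \<Rightarrow>
   (real ^ 'n \<Rightarrow> real \<Rightarrow> real ^ 'n ^ 'n) \<Rightarrow> 'n field \<Rightarrow> real ^ 'n \<Rightarrow> real ^ 'n \<Rightarrow>
   (real \<Rightarrow> real ^ 'n) \<Rightarrow> (real \<Rightarrow> real ^ 'n) \<Rightarrow> bool" where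
  "mild_equations I \<epsilon> t0 \<psi> A M B y0 w0 y w \<longleftrightarrow>
     continuous_on I (\<lambda>\<tau>. (y \<tau>, w \<tau>)) \<and> y 0 = y0 \<and> w 0 = w0 \<and>
     (\<forall>\<tau>\<in>I.
        y \<tau> = y0 + \<epsilon> *\<^sub>R integral {0..\<tau>} (\<lambda>s. w s + A (y s) (t0 + \<epsilon> * s)) \<and>
        w \<tau> = \<psi> \<tau> *\<^sub>R w0 + \<epsilon> *\<^sub>R integral {0..\<tau>}
          (\<lambda>s. \<psi> (\<tau> - s) *\<^sub>R (- (M (y s) (t0 + \<epsilon> * s) *v w s) + B (y s) (t0 + \<epsilon> * s))))"

definition global_mild_solution ::
  "(real ^ 'n) set \<Rightarrow> real \<Rightarrow> real \<Rightarrow> (real \<Rightarrow> real) \<Rightarrow> 'n::finite field \<Rightarrow>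
   (real ^ 'n \<Rightarrow> real \<Rightarrow> real ^ 'n ^ 'n) \<Rightarrow> 'n field \<Rightarrow> real ^ 'n \<Rightarrow> real ^ 'n \<Rightarrow>
   (real \<Rightarrow> real ^ 'n) \<Rightarrow> (real \<Rightarrow> real ^ 'n) \<Rightarrow> bool" where
  "global_mild_solution D \<epsilon> t0 \<psi> A M B y0 w0 y w \<longleftrightarrow>
     (\<forall>\<tau>\<ge>0. y \<tau> \<in> D) \<and> mild_equations {0..} \<epsilon> t0 \<psi> A M B y0 w0 y w"

text \<open>
  The fields are only given on \<open>D\<close>, so a particle that starts outside \<open>D\<close> or reaches the boundary
  of \<open>D\<close> in finite time has no global trajectory. The following condition excludes exactly this:
  a trajectory that is in \<open>D\<close> before time \<open>T\<close> is still in \<open>D\<close> at time \<open>T\<close>. The case \<open>T = 0\<close> says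
  that \<open>y0 \<in> D\<close>. For \<open>D = UNIV\<close> the condition is void, and all initial data are admissible.
\<close>

definition no_exit ::
  "(real ^ 'n) set \<Rightarrow> real \<Rightarrow> real \<Rightarrow> (real \<Rightarrow> real) \<Rightarrow> 'n::finite field \<Rightarrow>
   (real ^ 'n \<Rightarrow> real \<Rightarrow> real ^ 'n ^ 'n) \<Rightarrow> 'n field \<Rightarrow> real ^ 'n \<Rightarrow> real ^ 'n \<Rightarrow> bool" where
  "no_exit D \<epsilon> t0 \<psi> A M B y0 w0 \<longleftrightarrow>
     (\<forall>T\<ge>0. \<forall>y w. mild_equations {0..T} \<epsilon> t0 \<psi> A M B y0 w0 y w \<and> (\<forall>\<tau>\<in>{0..<T}. y \<tau> \<in> D)
        \<longrightarrow> y T \<in> D)"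

lemma no_exit_UNIV [simp]: "no_exit UNIV \<epsilon> t0 \<psi> A M B y0 w0"
  by (simp add: no_exit_def)

end

theory Submission
  imports Defs "HOL-Real_Asymp.Real_Asymp"
begin

text \<open>
  The regularity of \<open>u\<close> makes the fields \<open>A\<close>, \<open>M\<close>, \<open>B\<close> bounded and Lipschitz on the domain, so they
  extend to bounded Lipschitz fields on the whole space (McShane). For the extended fields the mild
  equations are a Volterra equation with a continuous kernel, where the unbounded term \<open>M w\<close> makes the
  integrand only locally Lipschitz, but of linear growth: Gronwall's inequality confines solutions on
  bounded intervals to a ball, on which Picard's theorem applies. At the first exit from the domain, the
  solution would also solve the original equations, contradicting the no-exit condition. The
  only property of \<open>\<psi>\<close> needed besides continuity is \<open>\<psi> 0 = 1\<close>, which is the initial value theorem for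
  its Laplace transform.
\<close>

section \<open>Bounded Lipschitz functions\<close>

text \<open>The factor \<open>\<psi> (\<tau> - s)\<close> couples w at time \<tau> to its whole
  past, so a local solution cannot simply be restarted at a later time as for an ordinary
  differential equation. Existence is therefore obtained on all of [0, T] at once, in a norm
  weighted in time so that every Lipschitz constant yields a contraction, and uniqueness makes the
  solutions for different T agree. The product of M(y, t), Lipschitz in y, with the unbounded
  variable w has no global Lipschitz constant; this is why boundedness accompanies the Lipschitz
  property throughout and why the state is truncated to a ball. The value of \<psi> at 0 enters
  because the second equation at \<tau> = 0 reads w(0) = \<psi>(0) w0, which has to match the
  prescribed initial value.\<close>

definition bounded_lipschitz_on :: "'a::metric_space set \<Rightarrow> ('a \<Rightarrow> 'b::real_normed_vector) \<Rightarrow> bool" where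
  "bounded_lipschitz_on S f \<longleftrightarrow> bounded (f ` S) \<and> (\<exists>L. L-lipschitz_on S f)"

lemma bounded_lipschitz_onI:
  assumes "\<And>x. x \<in> S \<Longrightarrow> norm (f x) \<le> B"
    and "\<And>x y. x \<in> S \<Longrightarrow> y \<in> S \<Longrightarrow> dist (f x) (f y) \<le> L * dist x y"
  shows "bounded_lipschitz_on S f"
proof -
  have "\<bar>L\<bar>-lipschitz_on S f"
    by (rule lipschitz_onI)
      (auto intro: order_trans[OF assms(2)] mult_right_mono[OF abs_ge_self zero_le_dist])
  then show ?thesis
    using assms(1) by (auto simp: bounded_lipschitz_on_def bounded_iff)
qed

lemma bounded_lipschitz_onE:
  assumes "bounded_lipschitz_on S f"
  obtains B L where "B \<ge> 0" "L \<ge> 0" "\<And>x. x \<in> S \<Longrightarrow> norm (f x) \<le> B"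
    "\<And>x y. x \<in> S \<Longrightarrow> y \<in> S \<Longrightarrow> dist (f x) (f y) \<le> L * dist x y"
proof -
  obtain B L where "\<And>x. x \<in> S \<Longrightarrow> norm (f x) \<le> B" "L-lipschitz_on S f"
    using assms by (auto simp: bounded_lipschitz_on_def bounded_iff)
  then show thesis
    using that[of "max B 0" L] lipschitz_on_nonneg lipschitz_onD by (metis max.cobounded2 max.coboundedI1)
qed

lemma bounded_lipschitz_on_const: "bounded_lipschitz_on S (\<lambda>x. c)"
  by (rule bounded_lipschitz_onI[where B = "norm c" and L = 0]) auto

lemma bounded_lipschitz_on_add:
  assumes "bounded_lipschitz_on S f" "bounded_lipschitz_on S g"
  shows "bounded_lipschitz_on S (\<lambda>x. f x + g x)"
  using assms lipschitz_on_add bounded_plus_comp unfolding bounded_lipschitz_on_def by blast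

lemma bounded_lipschitz_on_sum:
  assumes "\<And>i. i \<in> I \<Longrightarrow> bounded_lipschitz_on S (f i)"
  shows "bounded_lipschitz_on S (\<lambda>x. \<Sum>i\<in>I. f i x)"
  using assms
  by (induction I rule: infinite_finite_induct)
    (auto intro: bounded_lipschitz_on_add bounded_lipschitz_on_const)

lemma bounded_lipschitz_on_compose_bounded_linear:
  assumes "bounded_linear l" "bounded_lipschitz_on S f"
  shows "bounded_lipschitz_on S (\<lambda>x. l (f x))"
proof -
  interpret bounded_linear l by fact
  obtain K where K: "K \<ge> 0" "\<And>x. norm (l x) \<le> norm x * K"
    using nonneg_bounded by blast
  obtain B L where BL: "\<And>x. x \<in> S \<Longrightarrow> norm (f x) \<le> B" "B \<ge> 0" "L \<ge> 0"
    "\<And>x y. x \<in> S \<Longrightarrow> y \<in> S \<Longrightarrow> dist (f x) (f y) \<le> L * dist x y"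
    using bounded_lipschitz_onE[OF assms(2)] by metis
  show ?thesis
  proof (rule bounded_lipschitz_onI)
    show "norm (l (f x)) \<le> B * K" if "x \<in> S" for x
      using K(2)[of "f x"] mult_right_mono[OF BL(1)[OF that] K(1)] by linarith
    show "dist (l (f x)) (l (f y)) \<le> (L * K) * dist x y" if "x \<in> S" "y \<in> S" for x y
      using K(2)[of "f x - f y"] mult_right_mono[OF BL(4)[OF that] K(1)]
      by (simp add: dist_norm diff mult_ac)
  qed
qed

lemma bounded_lipschitz_on_diff:
  assumes "bounded_lipschitz_on S f" "bounded_lipschitz_on S g"
  shows "bounded_lipschitz_on S (\<lambda>x. f x - g x)"
  using bounded_lipschitz_on_add[OF assms(1)
      bounded_lipschitz_on_compose_bounded_linear[OF bounded_linear_minus[OF bounded_linear_ident] assms(2)]]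
  by simp

lemma bounded_lipschitz_on_scaleR:
  "bounded_lipschitz_on S f \<Longrightarrow> bounded_lipschitz_on S (\<lambda>x. c *\<^sub>R f x)"
  by (rule bounded_lipschitz_on_compose_bounded_linear[OF bounded_linear_scaleR_right])

text \<open>A difference of products splits into one difference per factor, each multiplied by the
  other factor, whose bound enters the constant. Products of Lipschitz functions without bounds need
  not be Lipschitz.\<close>

lemma bounded_lipschitz_on_bilinear:
  assumes "bounded_bilinear m" "bounded_lipschitz_on S f" "bounded_lipschitz_on S g"
  shows "bounded_lipschitz_on S (\<lambda>x. m (f x) (g x))"
proof -
  interpret bounded_bilinear m by fact
  obtain K where K: "K \<ge> 0" "\<And>x y. norm (m x y) \<le> norm x * norm y * K"
    using nonneg_bounded by blast
  obtain B L where f: "\<And>x. x \<in> S \<Longrightarrow> norm (f x) \<le> B" "B \<ge> 0" "L \<ge> 0"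
    "\<And>x y. x \<in> S \<Longrightarrow> y \<in> S \<Longrightarrow> dist (f x) (f y) \<le> L * dist x y"
    using bounded_lipschitz_onE[OF assms(2)] by metis
  obtain C M where g: "\<And>x. x \<in> S \<Longrightarrow> norm (g x) \<le> C" "C \<ge> 0" "M \<ge> 0"
    "\<And>x y. x \<in> S \<Longrightarrow> y \<in> S \<Longrightarrow> dist (g x) (g y) \<le> M * dist x y"
    using bounded_lipschitz_onE[OF assms(3)] by metis
  show ?thesis
  proof (rule bounded_lipschitz_onI)
    show "norm (m (f x) (g x)) \<le> B * C * K" if "x \<in> S" for x
      using K(1) f g that by (intro order_trans[OF K(2)] mult_right_mono mult_mono) auto
    fix x y assume xy: "x \<in> S" "y \<in> S"
    have "norm (m (f x - f y) (g x)) \<le> (L * dist x y) * C * K"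
      using K(1) f(2,3) f(4)[OF xy] g(1)[OF xy(1)]
      by (intro order_trans[OF K(2)] mult_right_mono mult_mono) (auto simp: dist_norm)
    moreover have "norm (m (f y) (g x - g y)) \<le> B * (M * dist x y) * K"
      using K(1) f(2) g(3) g(4)[OF xy] f(1)[OF xy(2)]
      by (intro order_trans[OF K(2)] mult_right_mono mult_mono) (auto simp: dist_norm)
    moreover have "m (f x) (g x) - m (f y) (g y) = m (f x - f y) (g x) + m (f y) (g x - g y)"
      by (simp add: diff_left diff_right)
    ultimately show "dist (m (f x) (g x)) (m (f y) (g y)) \<le> (L * C * K + B * M * K) * dist x y"
      using norm_triangle_ineq[of "m (f x - f y) (g x)" "m (f y) (g x - g y)"]
      by (simp add: dist_norm algebra_simps)
  qed
qed

lemma bounded_lipschitz_on_compose_lipschitz: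
  assumes f: "bounded_lipschitz_on T f" and g: "K-lipschitz_on S g" and "g ` S \<subseteq> T"
  shows "bounded_lipschitz_on S (\<lambda>x. f (g x))"
proof -
  obtain L where "L-lipschitz_on T f"
    using f by (auto simp: bounded_lipschitz_on_def)
  then have "(L * K)-lipschitz_on S (\<lambda>x. f (g x))"
    using g assms(3) by (intro lipschitz_on_compose2) (auto intro: lipschitz_on_subset)
  moreover have "bounded ((\<lambda>x. f (g x)) ` S)"
    using f assms(3) by (auto simp: bounded_lipschitz_on_def intro: bounded_subset)
  ultimately show ?thesis
    by (auto simp: bounded_lipschitz_on_def)
qed

lemma bounded_lipschitz_on_imp_continuous_on:
  "bounded_lipschitz_on S f \<Longrightarrow> continuous_on S f"
  unfolding bounded_lipschitz_on_def using lipschitz_on_continuous_on by blast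

text \<open>McShane's formula \<open>x \<mapsto> inf\<^sub>y (f y + L d(x, y))\<close>, cut off at the bounds of \<open>f\<close>.\<close>

lemma bounded_lipschitz_extension_real:
  fixes f :: "'a::metric_space \<Rightarrow> real"
  assumes "bounded_lipschitz_on S f"
  obtains g where "bounded_lipschitz_on UNIV g" "\<And>x. x \<in> S \<Longrightarrow> g x = f x"
proof (cases "S = {}")
  case True
  then show thesis
    using that[of "\<lambda>x. 0"] bounded_lipschitz_on_const by auto
next
  case False
  obtain B L where f: "\<And>x. x \<in> S \<Longrightarrow> \<bar>f x\<bar> \<le> B" "B \<ge> 0" "L \<ge> 0"
    "\<And>x y. x \<in> S \<Longrightarrow> y \<in> S \<Longrightarrow> dist (f x) (f y) \<le> L * dist x y"
    using assms by (metis bounded_lipschitz_onE real_norm_def)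
  define m where "m x = (INF y\<in>S. f y + L * dist x y)" for x
  \<comment> \<open>An infimum of reals is only usable over a set that is bounded below; the lower
    bound of \<open>f\<close> provides this, since the distance term is nonnegative.\<close>
  have bdd: "bdd_below ((\<lambda>y. f y + L * dist x y) ` S)" for x
    using f(1,3) by (intro bdd_belowI2[of _ "- B"]) (smt (verit) mult_nonneg_nonneg zero_le_dist)
  have m_le: "m x \<le> m y + L * dist x y" for x y
  proof -
    have "m x - L * dist x y \<le> m y"
      unfolding m_def[of y]
    proof (rule cINF_greatest[OF False])
      fix w assume "w \<in> S"
      then have "m x \<le> f w + L * dist x w"
        unfolding m_def by (intro cINF_lower bdd)
      also have "L * dist x w \<le> L * (dist x y + dist y w)"
        using f(3) by (intro mult_left_mono dist_triangle)
      finally show "m x - L * dist x y \<le> f w + L * dist y w"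
        by (simp add: algebra_simps)
    qed
    then show ?thesis
      by simp
  qed
  have m_eq: "m x = f x" if "x \<in> S" for x
  proof (rule antisym)
    show "m x \<le> f x"
      using cINF_lower[OF bdd that, of x] by (simp add: m_def)
    show "f x \<le> m x"
      unfolding m_def
    proof (rule cINF_greatest[OF False])
      fix y assume "y \<in> S"
      then show "f x \<le> f y + L * dist x y"
        using f(4)[OF that] by (smt (verit) dist_real_def)
    qed
  qed
  \<comment> \<open>The infimum may grow with the distance from \<open>S\<close>. Clamping to
    [-B, B] is nonexpansive, so the constant \<open>L\<close> survives.\<close>
  have "bounded_lipschitz_on UNIV (\<lambda>x. max (- B) (min B (m x)))"
  proof (rule bounded_lipschitz_onI)
    show "norm (max (- B) (min B (m x))) \<le> B" for x
      using f(2) by auto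
    show "dist (max (- B) (min B (m x))) (max (- B) (min B (m y))) \<le> L * dist x y" for x y
      using m_le[of x y] m_le[of y x] f(3) by (auto simp: dist_real_def dist_commute)
  qed
  moreover have "max (- B) (min B (m x)) = f x" if "x \<in> S" for x
    using f(1)[OF that] m_eq[OF that] by auto
  ultimately show thesis
    using that by blast
qed

text \<open>Each coordinate is extended separately. The Lipschitz constant may increase, which is
  harmless because only the existence of some constant is recorded.\<close>

lemma bounded_lipschitz_extension:
  fixes f :: "'a::metric_space \<Rightarrow> 'b::euclidean_space"
  assumes "bounded_lipschitz_on S f"
  obtains g where "bounded_lipschitz_on UNIV g" "\<And>x. x \<in> S \<Longrightarrow> g x = f x"
proof -
  have "\<exists>g. bounded_lipschitz_on UNIV g \<and> (\<forall>x\<in>S. g x = f x \<bullet> b)" for b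
    using bounded_lipschitz_extension_real[OF
        bounded_lipschitz_on_compose_bounded_linear[OF bounded_linear_inner_left assms]]
    by metis
  then obtain g where g: "\<And>b. bounded_lipschitz_on UNIV (g b)" "\<And>b x. x \<in> S \<Longrightarrow> g b x = f x \<bullet> b"
    by metis
  show thesis
  proof (rule that)
    show "bounded_lipschitz_on UNIV (\<lambda>x. \<Sum>b\<in>Basis. g b x *\<^sub>R b)"
      by (intro bounded_lipschitz_on_sum g
          bounded_lipschitz_on_compose_bounded_linear[OF bounded_linear_scaleR_left])
    show "(\<Sum>b\<in>Basis. g b x *\<^sub>R b) = f x" if "x \<in> S" for x
      using g(2)[OF that] by (simp add: euclidean_representation)
  qed
qed

text \<open>The extension also covers negative times, so that the kernel built from the extended
  fields is continuous for all real times.\<close>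

lemma bounded_lipschitz_field_extension:
  fixes f :: "'a::metric_space \<Rightarrow> real \<Rightarrow> 'b::euclidean_space"
  assumes "bounded_lipschitz_on (D \<times> {0..}) (\<lambda>(x, t). f x t)"
  obtains g where "bounded_lipschitz_on UNIV (\<lambda>(x, t). g x t)"
    "\<And>x t. x \<in> D \<Longrightarrow> 0 \<le> t \<Longrightarrow> g x t = f x t"
proof -
  obtain F where F: "bounded_lipschitz_on UNIV F"
    "\<And>p. p \<in> D \<times> {0..} \<Longrightarrow> F p = (\<lambda>(x, t). f x t) p"
    using bounded_lipschitz_extension[OF assms] by blast
  show thesis
    by (rule that[of "\<lambda>x t. F (x, t)"]) (use F in auto)
qed

section \<open>Regularity of the coefficient fields\<close>

lemma bounded_bilinear_matrix_vector_mult: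
  "bounded_bilinear ((*v) :: real^'n^'m \<Rightarrow> real^'n \<Rightarrow> real^'m)"
  unfolding bilinear_conv_bounded_bilinear[symmetric]
  by (auto simp: bilinear_def intro!: linearI
      simp: matrix_vector_mult_add_rdistrib matrix_vector_right_distrib
        matrix_vector_mult_scaleR scaleR_matrix_vector_assoc)

text \<open>\<open>bounded_lipschitz\<close> is tied to vector fields on space-time; the polymorphic
  notion also covers matrix fields and functions of other variables.\<close>

lemma bounded_lipschitz_iff:
  "bounded_lipschitz D f \<longleftrightarrow> bounded_lipschitz_on (D \<times> {0..}) (\<lambda>(x, t). f x t)"
  by (simp add: bounded_lipschitz_def bounded_lipschitz_on_def)

lemma bounded_lipschitz_on_cong:
  assumes "\<And>x. x \<in> S \<Longrightarrow> f x = g x"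
  shows "bounded_lipschitz_on S f \<longleftrightarrow> bounded_lipschitz_on S g"
  using assms image_cong[OF refl, of S f g] lipschitz_on_cong[OF refl refl, of S f g]
  by (auto simp: bounded_lipschitz_on_def)

text \<open>\<open>vector_derivative\<close> is a choice operator with an arbitrary value where no
  derivative exists, so additivity has to be restricted to points at which every summand is
  differentiable.\<close>

lemma partial_x_sum:
  fixes f :: "'k \<Rightarrow> 'n::finite field"
  assumes "\<And>k. k \<in> I \<Longrightarrow> partial_x_exists D j (f k)" "x \<in> D" "t \<ge> 0"
  shows "partial_x j (\<lambda>x t. \<Sum>k\<in>I. f k x t) x t = (\<Sum>k\<in>I. partial_x j (f k) x t)"
proof -
  have "((\<lambda>h. f k (x + h *\<^sub>R axis j 1) t) has_vector_derivative partial_x j (f k) x t) (at 0)"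
    if "k \<in> I" for k
    unfolding partial_x_def vector_derivative_works[symmetric]
    using assms that by (auto simp: partial_x_exists_def)
  then show ?thesis
    unfolding partial_x_def[of j "\<lambda>x t. \<Sum>k\<in>I. f k x t"]
    by (intro vector_derivative_at has_vector_derivative_sum)
qed

lemma partial_t_sum:
  fixes f :: "'k \<Rightarrow> 'n::finite field"
  assumes "\<And>k. k \<in> I \<Longrightarrow> partial_t_exists D (f k)" "x \<in> D" "t \<ge> 0"
  shows "partial_t (\<lambda>x t. \<Sum>k\<in>I. f k x t) x t = (\<Sum>k\<in>I. partial_t (f k) x t)"
proof -
  have "(f k x has_vector_derivative partial_t (f k) x t) (at t within {0..})"
    if "k \<in> I" for k
    unfolding partial_t_def vector_derivative_works[symmetric]
    using assms that by (auto simp: partial_t_exists_def)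
  \<comment> \<open>The one-sided derivative is unique also at \<open>t = 0\<close>, because the
    half-line contains points to the right of every \<open>t\<close>.\<close>
  moreover have "at t within {0..} \<noteq> bot"
    using assms(3) at_le[of "{t<..}" "{0..}" t] trivial_limit_at_right_real[of t]
    by (metis atLeast_iff bot.extremum_uniqueI greaterThan_iff less_imp_le order_trans subsetI)
  ultimately show ?thesis
    unfolding partial_t_def[of "\<lambda>x t. \<Sum>k\<in>I. f k x t"]
    by (intro vector_derivative_within has_vector_derivative_sum)
qed

text \<open>A matrix is the sum of its columns: \<open>?l j\<close> is the linear map that places a
  vector in column \<open>j\<close> of a matrix that is zero elsewhere.\<close>

lemma bounded_lipschitz_on_grad:
  fixes f :: "'n::finite field"
  assumes "\<And>j. bounded_lipschitz_on S (\<lambda>(x, t). partial_x j f x t)"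
  shows "bounded_lipschitz_on S (\<lambda>(x, t). grad f x t)"
proof -
  let ?l = "\<lambda>j (v :: real^'n). (\<chi> i k. if k = j then v $ i else 0) :: real^'n^'n"
  have "bounded_linear (?l j)" for j
    unfolding linear_conv_bounded_linear[symmetric]
    by (rule linearI) (auto simp: vec_eq_iff)
  then have "bounded_lipschitz_on S (\<lambda>p. \<Sum>j\<in>UNIV. ?l j (partial_x j f (fst p) (snd p)))"
    using assms
    by (intro bounded_lipschitz_on_sum bounded_lipschitz_on_compose_bounded_linear[of "?l _"])
      (auto simp: case_prod_unfold)
  moreover have "(\<Sum>j\<in>UNIV. ?l j (partial_x j f x t)) = grad f x t" for x t
    by (simp add: grad_def vec_eq_iff if_distrib cong: if_cong)
  ultimately show ?thesis
    by (simp add: case_prod_unfold)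
qed

text \<open>The top orders of the regularity assumption are those that occur here: the gradient of
  the Laplacian takes third space derivatives, and the material derivative of the Laplacian takes
  time derivatives of second space derivatives.\<close>

lemma regular_velocity_fields:
  fixes u :: "'n::finite field"
  assumes u: "regular_velocity D u"
  defines "S \<equiv> D \<times> {0..}"
  shows "bounded_lipschitz_on S (\<lambda>(x, t). A_field \<gamma> \<epsilon> u x t)"
    and "bounded_lipschitz_on S (\<lambda>(x, t). M_field \<gamma> \<epsilon> u x t)"
    and "bounded_lipschitz_on S (\<lambda>(x, t). B_field R \<gamma> \<epsilon> g u x t)"
proof -
  note bl_intros = bounded_lipschitz_on_add bounded_lipschitz_on_diff bounded_lipschitz_on_scaleR
    bounded_lipschitz_on_const bounded_lipschitz_on_bilinear[OF bounded_bilinear_matrix_vector_mult]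
  have laplacian_eq: "laplacian u = (\<lambda>x t. \<Sum>i\<in>UNIV. partials_x [i, i] u x t)"
    by (simp add: laplacian_def partials_x_def fun_eq_iff)
  have ex: "partial_x_exists D i (partials_x is u)" "partial_t_exists D (partials_x is u)"
    "bounded_lipschitz_on S (\<lambda>(x, t). partial_t (partials_x is u) x t)" if "length is \<le> 2" for i "is"
    using u that by (auto simp: regular_velocity_def bounded_lipschitz_iff S_def)
  have bl: "bounded_lipschitz_on S (\<lambda>(x, t). partials_x is u x t)" if "length is \<le> 3" for "is"
    using u that by (auto simp: regular_velocity_def bounded_lipschitz_iff S_def)
  have u0: "bounded_lipschitz_on S (\<lambda>p. u (fst p) (snd p))"
    using bl[of "[]"] by (simp add: partials_x_def case_prod_unfold)
  have ut: "bounded_lipschitz_on S (\<lambda>p. partial_t u (fst p) (snd p))"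
    using ex(3)[of "[]"] by (simp add: partials_x_def case_prod_unfold)
  have lap: "bounded_lipschitz_on S (\<lambda>p. laplacian u (fst p) (snd p))"
    unfolding laplacian_eq using bl
    by (intro bounded_lipschitz_on_sum) (auto simp: case_prod_unfold)
  have grad_u: "bounded_lipschitz_on S (\<lambda>p. grad u (fst p) (snd p))"
    using bounded_lipschitz_on_grad[of S u] bl[of "[_]"]
    by (simp add: partials_x_def case_prod_unfold)
  have "bounded_lipschitz_on S (\<lambda>(x, t). partial_x j (laplacian u) x t)" for j
  proof -
    have "bounded_lipschitz_on S (\<lambda>p. \<Sum>i\<in>UNIV. partials_x [j, i, i] u (fst p) (snd p))"
      using bl by (intro bounded_lipschitz_on_sum) (auto simp: case_prod_unfold)
    \<comment> \<open>The outer derivative has to pass through the sum before the assumption on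
      third derivatives applies. This is justified only on \<open>S\<close>, so the fields are
      compared there and not as functions.\<close>
    moreover have "partial_x j (laplacian u) x t = (\<Sum>i\<in>UNIV. partials_x [j, i, i] u x t)"
      if "(x, t) \<in> S" for x t
    proof -
      have "partials_x [j, i, i] u = partial_x j (partials_x [i, i] u)" for i
        by (simp add: partials_x_def)
      then show ?thesis
        unfolding laplacian_eq using that ex(1)
        by (subst partial_x_sum[where D = D]) (auto simp: S_def)
    qed
    ultimately show ?thesis
      by (subst bounded_lipschitz_on_cong) auto
  qed
  then have grad_lap: "bounded_lipschitz_on S (\<lambda>p. grad (laplacian u) (fst p) (snd p))"
    using bounded_lipschitz_on_grad by (auto simp: case_prod_unfold)
  have lap_t: "bounded_lipschitz_on S (\<lambda>p. partial_t (laplacian u) (fst p) (snd p))"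
  proof -
    have "bounded_lipschitz_on S (\<lambda>p. \<Sum>i\<in>UNIV. partial_t (partials_x [i, i] u) (fst p) (snd p))"
      using ex(3) by (intro bounded_lipschitz_on_sum) (auto simp: case_prod_unfold)
    moreover have "partial_t (laplacian u) x t = (\<Sum>i\<in>UNIV. partial_t (partials_x [i, i] u) x t)"
      if "(x, t) \<in> S" for x t
      unfolding laplacian_eq using that ex(2)
      by (subst partial_t_sum[where D = D]) (auto simp: S_def)
    ultimately show ?thesis
      by (subst bounded_lipschitz_on_cong) auto
  qed
  show "bounded_lipschitz_on S (\<lambda>(x, t). A_field \<gamma> \<epsilon> u x t)"
    unfolding A_field_def case_prod_unfold by (intro bl_intros u0 lap)
  show "bounded_lipschitz_on S (\<lambda>(x, t). M_field \<gamma> \<epsilon> u x t)"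
    unfolding M_field_def case_prod_unfold by (intro bl_intros grad_u grad_lap)
  show "bounded_lipschitz_on S (\<lambda>(x, t). B_field R \<gamma> \<epsilon> g u x t)"
    unfolding B_field_def material_derivative_def case_prod_unfold
    by (intro bl_intros u0 ut lap lap_t grad_u grad_lap)
qed

section \<open>Volterra integral equations\<close>

text \<open>Both the upper limit and the integrand depend on \<open>t\<close>. The substitution s =
  t r moves the integral to the fixed interval [0, 1], where continuity in a parameter is
  standard.\<close>

lemma continuous_on_integral_diagonal:
  fixes k :: "real \<Rightarrow> real \<Rightarrow> 'a::euclidean_space"
  assumes k: "continuous_on UNIV (\<lambda>(t, s). k t s)"
  shows "continuous_on {0..} (\<lambda>t. integral {0..t} (k t))"
proof -
  have k2: "continuous_on S (\<lambda>x. k (f x) (g x))"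
    if "continuous_on S f" "continuous_on S g" for S :: "'b::topological_space set" and f g
    using continuous_on_compose2[OF k continuous_on_Pair[OF that]] by auto
  have "integral {0..t} (k t) = integral (cbox 0 1) (\<lambda>r. t *\<^sub>R k t (t * r))" if "t \<ge> 0" for t
  proof -
    have "((\<lambda>r. t *\<^sub>R k t (t * r)) has_integral integral {t * 0..t * 1} (k t)) {0..1}"
      using that
      by (intro has_integral_substitution[where c = 0 and d = t])
        (auto intro!: k2 continuous_intros derivative_eq_intros simp: mult_left_le)
    then show ?thesis
      unfolding cbox_interval mult_zero_right mult_1_right by (rule integral_unique[symmetric])
  qed
  moreover have "continuous_on {0..} (\<lambda>t. integral (cbox 0 1) (\<lambda>r. t *\<^sub>R k t (t * r)))"
    by (rule integral_continuous_on_param)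
      (auto intro!: continuous_intros k2 simp: case_prod_unfold)
  ultimately show ?thesis
    by (subst continuous_on_cong) auto
qed

text \<open>The kernel sees both \<open>t\<close> and \<open>s\<close>, as a convolution requires.
  For \<open>T < 0\<close> the interval is empty and the predicate holds vacuously, so it can be
  stated for all \<open>T\<close> at once.\<close>

definition volterra_solution ::
  "real \<Rightarrow> (real \<Rightarrow> 'a::euclidean_space) \<Rightarrow> (real \<Rightarrow> real \<Rightarrow> 'a \<Rightarrow> 'a) \<Rightarrow> (real \<Rightarrow> 'a) \<Rightarrow> bool" where
  "volterra_solution T h G z \<longleftrightarrow> continuous_on {0..T} z \<and>
     (\<forall>t\<in>{0..T}. z t = h t + integral {0..t} (\<lambda>s. G t s (z s)))"

text \<open>In the norm weighted by \<open>exp (- l t)\<close> with \<open>l \<ge> 2 L\<close>, the Picard operator is a contraction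
  with constant \<open>1/2\<close> on the whole interval.\<close>

lemma volterra_Lipschitz_ex1:
  fixes G :: "real \<Rightarrow> real \<Rightarrow> 'a::euclidean_space \<Rightarrow> 'a"
  assumes T: "0 \<le> T" and h: "continuous_on {0..T} h"
    and G: "continuous_on UNIV (\<lambda>(t, s, x). G t s x)"
    and lip: "\<And>t s x y. 0 \<le> s \<Longrightarrow> s \<le> t \<Longrightarrow> t \<le> T \<Longrightarrow> norm (G t s x - G t s y) \<le> L * norm (x - y)"
  shows "\<exists>z. volterra_solution T h G z"
    and "volterra_solution T h G z1 \<Longrightarrow> volterra_solution T h G z2 \<Longrightarrow> t \<in> {0..T} \<Longrightarrow> z1 t = z2 t"
proof -
  \<comment> \<open>The maximum with 1 makes \<open>l\<close> positive for any sign of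
    \<open>L\<close>; the factor 2 is what gives the contraction constant 1/2.\<close>
  define l where "l = 2 * max L 1"
  have l: "l > 0" "L \<le> l / 2"
    by (auto simp: l_def)
  \<comment> \<open>Clamping time to [0, T] turns functions on the interval into bounded continuous
    functions on the real line, which form a complete type for Banach's theorem.\<close>
  define p where "p t = max 0 (min T t)" for t
  have p: "p t \<in> {0..T}" for t
    using T by (auto simp: p_def)
  have p_id: "p t = t" if "t \<in> {0..T}" for t
    using that by (auto simp: p_def)
  have cont_p: "continuous_on S p" for S
    unfolding p_def by (intro continuous_intros)
  have G3: "continuous_on S (\<lambda>x. G (e x) (f x) (g x))"
    if "continuous_on S e" "continuous_on S f" "continuous_on S g"
    for S :: "'b::topological_space set" and e f g
    using continuous_on_compose2[OF G continuous_on_Pair[OF that(1) continuous_on_Pair[OF that(2,3)]]]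
    by auto
  \<comment> \<open>This is the Picard operator in the unknown
    \<open>v t = exp (- l * t) *\<^sub>R z t\<close>: the weighted norm of \<open>z\<close> becomes
    the plain supremum norm of \<open>v\<close>.\<close>
  define F where "F v t = exp (- l * p t) *\<^sub>R
    (h (p t) + integral {0..p t} (\<lambda>s. G (p t) s (exp (l * s) *\<^sub>R v s)))" for v t
  have F_bcont: "F v \<in> bcontfun" if v: "continuous_on UNIV v" for v
  proof -
    have "continuous_on {0..} (\<lambda>t. integral {0..t} (\<lambda>s. G t s (exp (l * s) *\<^sub>R v s)))"
      by (rule continuous_on_integral_diagonal)
        (auto simp: case_prod_unfold intro!: G3 continuous_intros continuous_on_compose2[OF v])
    then have c: "continuous_on {0..T} (\<lambda>t. exp (- l * t) *\<^sub>R
        (h t + integral {0..t} (\<lambda>s. G t s (exp (l * s) *\<^sub>R v s))))" (is "continuous_on _ ?f")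
      by (intro continuous_intros h) (auto intro: continuous_on_subset)
    have F: "F v = (\<lambda>t. ?f (p t))"
      by (simp add: F_def fun_eq_iff)
    have "continuous_on UNIV (F v)"
      unfolding F using p by (intro continuous_on_compose2[OF c cont_p]) auto
    moreover have "bounded (?f ` {0..T})"
      using c compact_continuous_image compact_imp_bounded by blast
    then have "bounded (range (F v))"
      unfolding F by (rule bounded_subset) (use p in auto)
    ultimately show ?thesis
      by (simp add: bcontfun_def)
  qed
  define \<Phi> where "\<Phi> v = Bcontfun (F (apply_bcontfun v))" for v :: "real \<Rightarrow>\<^sub>C 'a"
  have \<Phi>: "apply_bcontfun (\<Phi> v) = F (apply_bcontfun v)" for v
    by (simp add: \<Phi>_def Bcontfun_inverse F_bcont)
  have "dist (\<Phi> v) (\<Phi> w) \<le> 1/2 * dist v w" for v w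
  proof (rule dist_bound)
    fix t0
    define t where "t = p t0"
    have t: "0 \<le> t" "t \<le> T"
      using p[of t0] by (auto simp: t_def)
    let ?k = "\<lambda>v s. G t s (exp (l * s) *\<^sub>R apply_bcontfun v s)"
    have int: "?k v integrable_on {0..t}" for v
      by (intro integrable_continuous_interval G3 continuous_intros) auto
    have exp_int: "((\<lambda>s. (l / 2 * dist v w) * exp (l * s)) has_integral
        (l / 2 * dist v w) * (exp (l * t) / l - exp (l * 0) / l)) {0..t}"
      using t l by (intro has_integral_mult_right fundamental_theorem_of_calculus)
        (auto intro!: derivative_eq_intros simp: has_real_derivative_iff_has_vector_derivative[symmetric])
    have "norm (integral {0..t} (?k v) - integral {0..t} (?k w))
        = norm (integral {0..t} (\<lambda>s. ?k v s - ?k w s))"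
      by (simp add: int integral_diff)
    also have "\<dots> \<le> integral {0..t} (\<lambda>s. (l / 2 * dist v w) * exp (l * s))"
    proof (rule integral_norm_bound_integral)
      fix s assume s: "s \<in> {0..t}"
      have "norm (?k v s - ?k w s)
          \<le> L * norm (exp (l * s) *\<^sub>R apply_bcontfun v s - exp (l * s) *\<^sub>R apply_bcontfun w s)"
        using s t by (intro lip) auto
      also have "\<dots> = L * exp (l * s) * dist (apply_bcontfun v s) (apply_bcontfun w s)"
        by (simp add: dist_norm flip: scaleR_diff_right)
      also have "\<dots> \<le> l / 2 * exp (l * s) * dist v w"
        using l by (intro mult_mono dist_bounded) auto
      finally show "norm (?k v s - ?k w s) \<le> (l / 2 * dist v w) * exp (l * s)"
        by (simp add: mult_ac)
    qed (use exp_int int in \<open>auto intro: integrable_diff\<close>)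
    also have "\<dots> = (l / 2 * dist v w) * (exp (l * t) / l - 1 / l)"
      using integral_unique[OF exp_int] unfolding mult_zero_right exp_zero .
    \<comment> \<open>Integrating the weight yields the factor 1/l, which cancels the
      \<open>l\<close> in \<open>l / 2\<close>; the subtracted term 1/l is dropped.\<close>
    also have "\<dots> \<le> 1/2 * dist v w * exp (l * t)"
      using l by (simp add: field_simps)
    finally have "exp (- l * t) * norm (integral {0..t} (?k v) - integral {0..t} (?k w))
        \<le> exp (- l * t) * (1/2 * dist v w * exp (l * t))"
      by (intro mult_left_mono) auto
    also have "\<dots> = 1/2 * dist v w"
      by (simp add: exp_minus)
    finally show "dist (apply_bcontfun (\<Phi> v) t0) (apply_bcontfun (\<Phi> w) t0) \<le> 1/2 * dist v w"
      by (simp add: \<Phi> F_def t_def[symmetric] dist_norm[of "_ *\<^sub>R _"] flip: scaleR_diff_right)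
  qed
  then have ex1: "\<exists>!v. \<Phi> v = v"
    by (intro banach_fix_type[where c = "1/2"]) auto
  show "\<exists>z. volterra_solution T h G z"
  proof -
    obtain v where v: "\<Phi> v = v"
      using ex1 by blast
    have "volterra_solution T h G (\<lambda>t. exp (l * t) *\<^sub>R apply_bcontfun v t)"
      unfolding volterra_solution_def
    proof (intro conjI ballI continuous_intros)
      fix t assume t: "t \<in> {0..T}"
      have "apply_bcontfun v t = F (apply_bcontfun v) t"
        using v \<Phi> by metis
      then show "exp (l * t) *\<^sub>R apply_bcontfun v t
          = h t + integral {0..t} (\<lambda>s. G t s (exp (l * s) *\<^sub>R apply_bcontfun v s))"
        using p_id[OF t] by (simp add: F_def exp_minus)
    qed auto
    then show ?thesis
      by blast
  qed
  \<comment> \<open>Every solution, rescaled and continued constantly outside [0, T], is a fixed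
    point, so two solutions have the same image under \<open>B\<close>.\<close>
  define B where "B z = Bcontfun (\<lambda>t. exp (- l * p t) *\<^sub>R z (p t))" for z :: "real \<Rightarrow> 'a"
  have B: "apply_bcontfun (B z) = (\<lambda>t. exp (- l * p t) *\<^sub>R z (p t))" and "\<Phi> (B z) = B z"
    if z: "volterra_solution T h G z" for z
  proof -
    have c: "continuous_on {0..T} (\<lambda>t. exp (- l * t) *\<^sub>R z t)"
      using z by (intro continuous_intros) (auto simp: volterra_solution_def)
    have "continuous_on UNIV (\<lambda>t. exp (- l * p t) *\<^sub>R z (p t))"
      using p by (intro continuous_on_compose2[OF c cont_p]) auto
    moreover have "bounded ((\<lambda>t. exp (- l * t) *\<^sub>R z t) ` {0..T})"
      using c compact_continuous_image compact_imp_bounded by blast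
    then have "bounded (range (\<lambda>t. exp (- l * p t) *\<^sub>R z (p t)))"
      by (rule bounded_subset) (use p in auto)
    ultimately show B: "apply_bcontfun (B z) = (\<lambda>t. exp (- l * p t) *\<^sub>R z (p t))"
      by (simp add: B_def Bcontfun_inverse bcontfun_def)
    show "\<Phi> (B z) = B z"
    proof (rule bcontfun_eqI)
      fix t
      have "integral {0..p t} (\<lambda>s. G (p t) s (exp (l * s) *\<^sub>R apply_bcontfun (B z) s))
          = integral {0..p t} (\<lambda>s. G (p t) s (z s))"
        using p[of t] by (intro integral_cong) (simp add: B p_id exp_minus)
      then show "apply_bcontfun (\<Phi> (B z)) t = apply_bcontfun (B z) t"
        using z p[of t] by (simp add: \<Phi> F_def B volterra_solution_def)
    qed
  qed
  then show "z1 t = z2 t" if "volterra_solution T h G z1" "volterra_solution T h G z2" "t \<in> {0..T}"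
  proof -
    have "B z1 = B z2"
      using ex1 that \<open>\<And>z. volterra_solution T h G z \<Longrightarrow> \<Phi> (B z) = B z\<close> by blast
    then have "exp (- l * p t) *\<^sub>R z1 (p t) = exp (- l * p t) *\<^sub>R z2 (p t)"
      using B that by metis
    then show ?thesis
      using p_id that by simp
  qed
qed

section \<open>A priori bounds\<close>

text \<open>At a maximum point of \<open>exp (- 2 * b * t) * f t\<close>, with value
  \<open>M\<close>, the integral term contributes at most M/2, so M \<le> a + M/2. The rate 2b,
  twice that of the sharp inequality, creates this half and causes the factor 2.\<close>

lemma Gronwall_bound:
  fixes f :: "real \<Rightarrow> real"
  assumes f: "continuous_on {0..T} f"
    and a: "0 \<le> a" and b: "0 < b"
    and le: "\<And>t. t \<in> {0..T} \<Longrightarrow> f t \<le> a + b * integral {0..t} f"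
    and t: "t \<in> {0..T}"
  shows "f t \<le> 2 * a * exp (2 * b * t)"
proof -
  have "continuous_on {0..T} (\<lambda>t. exp (- 2 * b * t) * f t)"
    by (intro continuous_intros f)
  then obtain m where m: "m \<in> {0..T}"
    and max: "\<And>s. s \<in> {0..T} \<Longrightarrow> exp (- 2 * b * s) * f s \<le> exp (- 2 * b * m) * f m"
    using continuous_attains_sup[of "{0..T}" "\<lambda>t. exp (- 2 * b * t) * f t"] t by auto
  define M where "M = exp (- 2 * b * m) * f m"
  have f_le: "f s \<le> M * exp (2 * b * s)" if "s \<in> {0..T}" for s
    using mult_left_mono[OF max[OF that], of "exp (2 * b * s)"]
    by (simp add: M_def exp_minus mult_ac)
  have exp_int: "((\<lambda>s. M * exp (2 * b * s)) has_integral
      M * (exp (2 * b * m) / (2 * b) - exp (2 * b * 0) / (2 * b))) {0..m}"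
    using m b by (intro has_integral_mult_right fundamental_theorem_of_calculus)
      (auto intro!: derivative_eq_intros simp: has_real_derivative_iff_has_vector_derivative[symmetric])
  have "M \<le> 2 * a"
  \<comment> \<open>\<open>f\<close> may be negative; a negative \<open>M\<close> lies below
    \<open>2 * a\<close> at once.\<close>
  proof (cases "M \<ge> 0")
    case True
    have "integral {0..m} f \<le> integral {0..m} (\<lambda>s. M * exp (2 * b * s))"
      using m exp_int f_le f
      by (intro integral_le) (auto intro!: integrable_continuous_interval continuous_intros intro: continuous_on_subset[OF f])
    also have "\<dots> = M * (exp (2 * b * m) / (2 * b) - 1 / (2 * b))"
      using integral_unique[OF exp_int] unfolding mult_zero_right exp_zero .
    also have "\<dots> \<le> M * (exp (2 * b * m) / (2 * b))"
      using True b by (intro mult_left_mono) auto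
    finally have "f m \<le> a + b * (M * (exp (2 * b * m) / (2 * b)))"
      using le[OF m] b by (smt (verit) mult_left_mono)
    then have "M \<le> exp (- 2 * b * m) * (a + M * exp (2 * b * m) / 2)"
      unfolding M_def using b by (intro mult_left_mono) auto
    also have "\<dots> = exp (- 2 * b * m) * a + M / 2"
      by (simp add: exp_minus field_simps)
    also have "exp (- 2 * b * m) * a \<le> 1 * a"
      using a b m by (intro mult_right_mono) auto
    finally show ?thesis
      by simp
  qed (use a in auto)
  then show ?thesis
    using f_le[OF t] by (smt (verit) mult_right_mono exp_ge_zero)
qed


text \<open>The constant part of the growth bound integrates to at most c T and joins
  \<open>H\<close> as the initial value in Gronwall's inequality. The final bound is uniform in
  \<open>t\<close>, so it can serve as the radius of a ball.\<close>

lemma volterra_solution_bound: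
  assumes z: "volterra_solution T h G z"
    and G: "continuous_on UNIV (\<lambda>(t, s, x). G t s x)"
    and c: "c > 0"
    and growth: "\<And>t s x. 0 \<le> s \<Longrightarrow> s \<le> t \<Longrightarrow> t \<le> T \<Longrightarrow> norm (G t s x) \<le> c * (1 + norm x)"
    and H: "\<And>t. t \<in> {0..T} \<Longrightarrow> norm (h t) \<le> H"
    and t: "t \<in> {0..T}"
  shows "norm (z t) \<le> 2 * (H + c * T) * exp (2 * c * T)"
proof -
  have cz: "continuous_on {0..T} z"
    using z by (simp add: volterra_solution_def)
  have H0: "0 \<le> H"
    using H[OF t] norm_ge_zero order_trans by blast
  have "norm (z t) \<le> 2 * (H + c * T) * exp (2 * c * t)"
  proof (rule Gronwall_bound[OF continuous_on_norm[OF cz] _ c _ t])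
    fix t assume t: "t \<in> {0..T}"
    have cz': "continuous_on {0..t} z"
      using cz t by (auto intro: continuous_on_subset)
    have "norm (integral {0..t} (\<lambda>s. G t s (z s))) \<le> integral {0..t} (\<lambda>s. c * (1 + norm (z s)))"
    proof (intro integral_norm_bound_integral integrable_continuous_interval)
      show "continuous_on {0..t} (\<lambda>s. G t s (z s))"
        using continuous_on_compose2[OF G
            continuous_on_Pair[OF continuous_on_const[of _ t] continuous_on_Pair[OF continuous_on_id cz']]]
        by simp
    qed (use t growth in \<open>auto intro!: continuous_intros cz'\<close>)
    also have "\<dots> = c * t + c * integral {0..t} (\<lambda>s. norm (z s))"
      using t cz'
      unfolding integral_mult_right
      by (subst integral_add)
        (auto simp: algebra_simps intro!: integrable_continuous_interval continuous_intros)
    also have "c * t \<le> c * T"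
      using t c by simp
    finally have "norm (integral {0..t} (\<lambda>s. G t s (z s)))
        \<le> c * T + c * integral {0..t} (\<lambda>s. norm (z s))"
      by simp
    moreover have "z t = h t + integral {0..t} (\<lambda>s. G t s (z s))"
      using z t by (simp add: volterra_solution_def)
    ultimately show "norm (z t) \<le> H + c * T + c * integral {0..t} (\<lambda>s. norm (z s))"
      using H[OF t] norm_triangle_ineq[of "h t" "integral {0..t} (\<lambda>s. G t s (z s))"] by simp
  qed (use H0 c t in auto)
  also have "\<dots> \<le> 2 * (H + c * T) * exp (2 * c * T)"
    using t c H0 by (intro mult_left_mono) auto
  finally show ?thesis .
qed

text \<open>By the a priori bound, solutions do not change when \<open>G t s\<close> is composed with the metric
  projection onto a large ball, which makes it globally Lipschitz.\<close>

lemma volterra_ex1_interval: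
  fixes G :: "real \<Rightarrow> real \<Rightarrow> 'a::euclidean_space \<Rightarrow> 'a"
  assumes T: "0 \<le> T" and h: "continuous_on {0..T} h"
    and G: "continuous_on UNIV (\<lambda>(t, s, x). G t s x)"
    and growth: "\<exists>c. \<forall>t s x. 0 \<le> s \<and> s \<le> t \<and> t \<le> T \<longrightarrow> norm (G t s x) \<le> c * (1 + norm x)"
    and lip: "\<And>r. \<exists>L. \<forall>t s. \<forall>x\<in>cball 0 r. \<forall>y\<in>cball 0 r.
      0 \<le> s \<and> s \<le> t \<and> t \<le> T \<longrightarrow> norm (G t s x - G t s y) \<le> L * norm (x - y)"
  shows "\<exists>z. volterra_solution T h G z"
    and "volterra_solution T h G z1 \<Longrightarrow> volterra_solution T h G z2 \<Longrightarrow> t \<in> {0..T} \<Longrightarrow> z1 t = z2 t"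
proof -
  obtain c0 where c0:
    "\<And>t s x. 0 \<le> s \<Longrightarrow> s \<le> t \<Longrightarrow> t \<le> T \<Longrightarrow> norm (G t s x) \<le> c0 * (1 + norm x)"
    using growth by blast
  \<comment> \<open>Gronwall's inequality is stated for a positive rate, while the growth constant
    comes without a sign.\<close>
  define c where "c = max c0 1"
  have c: "c > 0"
    by (simp add: c_def)
  have growth_c: "norm (G t s x) \<le> c * (1 + norm x)" if "0 \<le> s" "s \<le> t" "t \<le> T" for t s x
    using c0[OF that, of x] mult_right_mono[of c0 c "1 + norm x"] by (simp add: c_def)
  have "bounded (h ` {0..T})"
    using h compact_continuous_image compact_imp_bounded by blast
  then obtain H where H: "\<And>t. t \<in> {0..T} \<Longrightarrow> norm (h t) \<le> H"
    unfolding bounded_iff by blast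
  define r where "r = 2 * (H + c * T) * exp (2 * c * T)"
  have "0 \<le> H"
    using H[of 0] T norm_ge_zero[of "h 0"] by (simp del: norm_ge_zero)
  then have r: "0 \<le> r"
    using T c by (auto simp: r_def)
  define P where "P = closest_point (cball (0::'a) r)"
  have P_id: "P x = x" if "norm x \<le> r" for x
    using that by (simp add: P_def closest_point_self)
  have P_in: "P x \<in> cball 0 r" for x
    unfolding P_def using r by (intro closest_point_in_set) auto
  have P_lip: "norm (P x - P y) \<le> norm (x - y)" for x y
    using closest_point_lipschitz[of "cball (0::'a) r" x y] r by (simp add: P_def dist_norm)
  \<comment> \<open>The projection is nonexpansive and fixes 0. Hence the truncated kernel obeys the
    same growth bound, and the same radius \<open>r\<close> confines the solutions of both
    equations.\<close>
  have P_norm: "norm (P x) \<le> norm x" for x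
    using P_lip[of x 0] P_id[of 0] r by simp
  have P_cont: "continuous_on S P" for S
    using r unfolding P_def by (intro continuous_on_closest_point) auto
  define G' where "G' t s x = G t s (P x)" for t s x
  have G'_cont: "continuous_on UNIV (\<lambda>(t, s, x). G' t s x)"
  proof -
    have "continuous_on UNIV (\<lambda>(t :: real, s :: real, x). (t, s, P x))"
      unfolding case_prod_unfold by (intro continuous_intros continuous_on_compose2[OF P_cont[of UNIV]]) auto
    then show ?thesis
      using continuous_on_compose2[OF G, of UNIV "\<lambda>(t, s, x). (t, s, P x)"]
      by (simp add: G'_def case_prod_unfold)
  qed
  have G'_growth: "norm (G' t s x) \<le> c * (1 + norm x)" if "0 \<le> s" "s \<le> t" "t \<le> T" for t s x
    unfolding G'_def using c
    by (intro order_trans[OF growth_c[OF that]] mult_left_mono add_left_mono P_norm) auto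
  obtain L0 where L0: "\<And>t s x y. \<lbrakk>x \<in> cball 0 r; y \<in> cball 0 r; 0 \<le> s; s \<le> t; t \<le> T\<rbrakk>
      \<Longrightarrow> norm (G t s x - G t s y) \<le> L0 * norm (x - y)"
    using lip by blast
  define L where "L = max L0 0"
  have G'_lip: "norm (G' t s x - G' t s y) \<le> L * norm (x - y)" if "0 \<le> s" "s \<le> t" "t \<le> T" for t s x y
  proof -
    have "norm (G' t s x - G' t s y) \<le> L0 * norm (P x - P y)"
      unfolding G'_def using that by (intro L0 P_in)
    also have "\<dots> \<le> L * norm (x - y)"
      unfolding L_def by (intro mult_mono P_lip) auto
    finally show ?thesis .
  qed
  have sol_iff: "volterra_solution T h G z \<longleftrightarrow> volterra_solution T h G' z"
    if bound: "\<And>t. t \<in> {0..T} \<Longrightarrow> norm (z t) \<le> r" for z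
  proof -
    have "integral {0..t} (\<lambda>s. G t s (z s)) = integral {0..t} (\<lambda>s. G' t s (z s))" if "t \<in> {0..T}" for t
      using that bound by (intro integral_cong) (simp add: G'_def P_id)
    then show ?thesis
      by (simp add: volterra_solution_def)
  qed
  have bound: "norm (z t) \<le> r" if "volterra_solution T h G z" "t \<in> {0..T}" for z t
    unfolding r_def using volterra_solution_bound[OF that(1) G c growth_c H that(2)] by simp
  have bound': "norm (z t) \<le> r" if "volterra_solution T h G' z" "t \<in> {0..T}" for z t
    unfolding r_def using volterra_solution_bound[OF that(1) G'_cont c G'_growth H that(2)] by simp
  show "\<exists>z. volterra_solution T h G z"
    using volterra_Lipschitz_ex1(1)[OF T h G'_cont G'_lip] sol_iff bound' by blast
  show "volterra_solution T h G z1 \<Longrightarrow> volterra_solution T h G z2 \<Longrightarrow> t \<in> {0..T} \<Longrightarrow> z1 t = z2 t"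
    using volterra_Lipschitz_ex1(2)[OF T h G'_cont G'_lip] sol_iff bound by blast
qed

section \<open>From bounded intervals to the half-line\<close>

lemma volterra_solution_mono:
  "volterra_solution T h G z \<Longrightarrow> S \<le> T \<Longrightarrow> volterra_solution S h G z"
  unfolding volterra_solution_def by (auto intro: continuous_on_subset)

lemma volterra_solution_cong:
  assumes "\<And>t. t \<in> {0..T} \<Longrightarrow> z t = z' t"
  shows "volterra_solution T h G z \<longleftrightarrow> volterra_solution T h G z'"
proof -
  have "integral {0..t} (\<lambda>s. G t s (z s)) = integral {0..t} (\<lambda>s. G t s (z' s))" if "t \<in> {0..T}" for t
    using assms that by (intro integral_cong) auto
  moreover have "continuous_on {0..T} z \<longleftrightarrow> continuous_on {0..T} z'"
    using assms by (intro continuous_on_cong) auto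
  ultimately show ?thesis
    using assms by (simp add: volterra_solution_def)
qed

text \<open>The global solution is the diagonal of the family of solutions on [0, T]: by uniqueness
  on [0, t], all members with T \<ge> t take the same value at \<open>t\<close>.\<close>

lemma volterra_ex_global:
  fixes G :: "real \<Rightarrow> real \<Rightarrow> 'a::euclidean_space \<Rightarrow> 'a"
  assumes h: "continuous_on {0..} h"
    and G: "continuous_on UNIV (\<lambda>(t, s, x). G t s x)"
    and growth: "\<And>T. \<exists>c. \<forall>t s x. 0 \<le> s \<and> s \<le> t \<and> t \<le> T \<longrightarrow> norm (G t s x) \<le> c * (1 + norm x)"
    and lip: "\<And>T r. \<exists>L. \<forall>t s. \<forall>x\<in>cball 0 r. \<forall>y\<in>cball 0 r.
      0 \<le> s \<and> s \<le> t \<and> t \<le> T \<longrightarrow> norm (G t s x - G t s y) \<le> L * norm (x - y)"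
  obtains z where "continuous_on {0..} z" "\<And>T. volterra_solution T h G z"
proof -
  have hT: "continuous_on {0..T} h" for T
    using h by (rule continuous_on_subset) auto
  have "\<forall>T. 0 \<le> T \<longrightarrow> (\<exists>z. volterra_solution T h G z)"
    using volterra_ex1_interval(1)[OF _ hT G growth lip] by blast
  then obtain Z where Z: "\<And>T. 0 \<le> T \<Longrightarrow> volterra_solution T h G (Z T)"
    by metis
  define z where "z t = Z t t" for t
  have "Z T t = z t" if "t \<in> {0..T}" for t T
    unfolding z_def using that
    by (intro volterra_ex1_interval(2)[OF _ hT[of t] G growth lip])
      (auto intro: volterra_solution_mono[OF Z] Z)
  then have sol: "volterra_solution T h G z" for T
  proof (cases "0 \<le> T")
    case True
    then show ?thesis
      using Z[OF True] \<open>\<And>t T. t \<in> {0..T} \<Longrightarrow> Z T t = z t\<close> volterra_solution_cong[of T "Z T" z h G] by blast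
  qed (simp add: volterra_solution_def)
  have "continuous_on {0..} z"
  proof (rule continuous_on_eq_continuous_within[THEN iffD2], rule ballI)
    fix t :: real assume "t \<in> {0..}"
    then have "continuous (at t within {0..t + 1}) z"
      using sol[of "t + 1"] by (auto simp: volterra_solution_def continuous_on_eq_continuous_within)
    \<comment> \<open>The margin 1 makes [0, t + 1] a neighbourhood of \<open>t\<close> relative to
      the half-line.\<close>
    moreover have "at t within {0..} = at t within {0..t + 1}"
      by (rule at_within_nhd[of _ "{..<t + 1}"]) auto
    ultimately show "continuous (at t within {0..}) z"
      by simp
  qed
  then show thesis
    using sol that by blast
qed

section \<open>Initial value of the kernel\<close>

text \<open>After replacing \<open>f\<close> by \<open>g = f - f 0\<close>: where \<open>\<bar>g\<bar> \<le> \<eta>\<close> on \<open>[0, \<delta>)\<close>, the integrand is at most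
  \<open>\<eta> exp (- x t)\<close>; beyond \<open>\<delta>\<close> it is at most \<open>exp (- (x - 1) \<delta>) exp (- t) \<bar>g t\<bar>\<close>.\<close>

lemma laplace_initial_value:
  fixes f :: "real \<Rightarrow> real"
  assumes f: "continuous_on {0..} f"
    and int: "\<And>x. x > 0 \<Longrightarrow> (\<lambda>t. exp (- x * t) * f t) absolutely_integrable_on {0..}"
  shows "((\<lambda>x. x * integral {0..} (\<lambda>t. exp (- x * t) * f t)) \<longlongrightarrow> f 0) at_top"
proof -
  define g where "g t = f t - f 0" for t
  have exp_int: "((\<lambda>t. exp (- x * t)) has_integral 1 / x) {0..}" if "x > 0" for x :: real
    using has_integral_exp_minus_to_infinity[OF that, of 0] by simp
  have g_abs: "(\<lambda>t. exp (- x * t) * g t) absolutely_integrable_on {0..}" if "x > 0" for x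
  proof -
    have "(\<lambda>t. exp (- x * t)) absolutely_integrable_on {0..}"
      using exp_int[OF that] by (intro nonnegative_absolutely_integrable_1) auto
    then have "(\<lambda>t. exp (- x * t) * f t - exp (- x * t) * f 0) absolutely_integrable_on {0..}"
      by (intro set_integral_diff int that set_integrable_mult_left) auto
    then show ?thesis
      by (simp add: g_def algebra_simps)
  qed
  \<comment> \<open>The transform at x = 1 supplies one finite constant for the tails at all larger
    x.\<close>
  define C where "C = integral {0..} (\<lambda>t. \<bar>exp (- 1 * t) * g t\<bar>)"
  have C_int: "((\<lambda>t. \<bar>exp (- 1 * t) * g t\<bar>) has_integral C) {0..}"
    unfolding C_def using g_abs[of 1]
    by (intro integrable_integral) (simp add: absolutely_integrable_on_def)
  have g_bound: "\<bar>x * integral {0..} (\<lambda>t. exp (- x * t) * g t)\<bar> \<le> \<eta> + x * exp (- (x - 1) * \<delta>) * C"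
    if \<delta>: "\<And>t. 0 \<le> t \<Longrightarrow> t < \<delta> \<Longrightarrow> \<bar>g t\<bar> \<le> \<eta>" and "\<eta> \<ge> 0" and x: "x \<ge> 1" for \<eta> \<delta> x
  proof -
    have I: "((\<lambda>t. exp (- x * t) * \<eta> + exp (- (x - 1) * \<delta>) * \<bar>exp (- 1 * t) * g t\<bar>)
        has_integral (1 / x * \<eta> + exp (- (x - 1) * \<delta>) * C)) {0..}"
      using x by (intro has_integral_add has_integral_mult_right has_integral_mult_left exp_int C_int) auto
    have "norm (integral {0..} (\<lambda>t. exp (- x * t) * g t)) \<le> 1 / x * \<eta> + exp (- (x - 1) * \<delta>) * C"
      unfolding integral_unique[OF I, symmetric]
    proof (rule integral_norm_bound_integral)
      show "(\<lambda>t. exp (- x * t) * g t) integrable_on {0..}"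
        using g_abs[of x] x by (auto simp: absolutely_integrable_on_def)
      fix t :: real assume t: "t \<in> {0..}"
      show "norm (exp (- x * t) * g t) \<le> exp (- x * t) * \<eta> + exp (- (x - 1) * \<delta>) * \<bar>exp (- 1 * t) * g t\<bar>"
      proof (cases "t < \<delta>")
        case True
        then have "exp (- x * t) * \<bar>g t\<bar> \<le> exp (- x * t) * \<eta>"
          using \<delta> t by (intro mult_left_mono) auto
        then show ?thesis
          by (simp add: abs_mult add_increasing2)
      next
        case False
        then have "(x - 1) * \<delta> \<le> (x - 1) * t"
          using x by (intro mult_left_mono) auto
        then have "exp (- x * t) \<le> exp (- (x - 1) * \<delta>) * exp (- 1 * t)"
          by (simp add: algebra_simps flip: exp_add)
        then have "exp (- x * t) * \<bar>g t\<bar> \<le> exp (- (x - 1) * \<delta>) * exp (- 1 * t) * \<bar>g t\<bar>"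
          by (rule mult_right_mono) auto
        then show ?thesis
          using \<open>\<eta> \<ge> 0\<close> by (simp add: abs_mult add_increasing mult.assoc)
      qed
    qed (use I in auto)
    then have "x * norm (integral {0..} (\<lambda>t. exp (- x * t) * g t)) \<le> x * (1 / x * \<eta> + exp (- (x - 1) * \<delta>) * C)"
      using x by (intro mult_left_mono) auto
    then show ?thesis
      using x by (simp add: abs_mult distrib_left mult.assoc)
  qed
  have "((\<lambda>x. x * integral {0..} (\<lambda>t. exp (- x * t) * g t)) \<longlongrightarrow> 0) at_top"
  proof (rule tendstoI)
    fix e :: real assume e: "e > 0"
    have "continuous (at 0 within {0..}) f"
      using f by (auto simp: continuous_on_eq_continuous_within)
    then obtain \<delta> where \<delta>: "\<delta> > 0" "\<And>t. 0 \<le> t \<Longrightarrow> t < \<delta> \<Longrightarrow> \<bar>g t\<bar> \<le> e / 2"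
    proof -
      have "e / 2 > 0"
        using e by simp
      then obtain \<delta> where "\<delta> > 0" "\<forall>t\<in>{0..}. dist t 0 < \<delta> \<longrightarrow> dist (f t) (f 0) < e / 2"
        using \<open>continuous (at 0 within {0..}) f\<close> unfolding continuous_within_eps_delta by blast
      then show thesis
        by (intro that[of \<delta>]) (auto simp: g_def dist_real_def intro: less_imp_le)
    qed
    have "((\<lambda>x. x * exp (- (x - 1) * \<delta>) * C) \<longlongrightarrow> 0) at_top"
      using \<delta>(1) by real_asymp
    then have "eventually (\<lambda>x. x * exp (- (x - 1) * \<delta>) * C < e / 2) at_top"
      using e by (intro order_tendstoD(2)[of _ 0]) auto
    with eventually_ge_at_top[of 1]
    show "eventually (\<lambda>x. dist (x * integral {0..} (\<lambda>t. exp (- x * t) * g t)) 0 < e) at_top"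
    proof eventually_elim
      case (elim x)
      then show ?case
        using g_bound[of \<delta> "e / 2" x] \<delta>(2) e by (simp add: dist_real_def)
    qed
  qed
  then have "((\<lambda>x. x * integral {0..} (\<lambda>t. exp (- x * t) * g t) + f 0) \<longlongrightarrow> 0 + f 0) at_top"
    by (intro tendsto_intros)
  moreover have "x * integral {0..} (\<lambda>t. exp (- x * t) * g t) + f 0 = x * integral {0..} (\<lambda>t. exp (- x * t) * f t)"
    if "x > 0" for x
  proof -
    have "((\<lambda>t. exp (- x * t) * g t + exp (- x * t) * f 0) has_integral
        (integral {0..} (\<lambda>t. exp (- x * t) * g t) + 1 / x * f 0)) {0..}"
      using g_abs[OF that] exp_int[OF that]
      by (intro has_integral_add has_integral_mult_left integrable_integral)
        (auto simp: absolutely_integrable_on_def)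
    then have "integral {0..} (\<lambda>t. exp (- x * t) * f t) = integral {0..} (\<lambda>t. exp (- x * t) * g t) + 1 / x * f 0"
      by (intro integral_unique) (simp add: g_def algebra_simps)
    then show ?thesis
      using that by (simp add: algebra_simps)
  qed
  ultimately show ?thesis
    by (subst tendsto_cong[OF eventually_mono[OF eventually_gt_at_top[of 0]]]) auto
qed

text \<open>As x tends to infinity, x / (x + \<kappa> sqrt x + 1) tends to 1, because the square
  root is of lower order.\<close>

lemma psi_0_eq_1:
  assumes cont: "continuous_on {0..} \<psi>"
    and laplace: "has_laplace_transform \<psi> (\<lambda>s. 1 / (s + of_real \<kappa> * csqrt s + 1))"
  shows "\<psi> 0 = 1"
proof -
  \<comment> \<open>On the positive real axis \<open>csqrt\<close> is the real square root, and the
    complex Lebesgue integral becomes a real gauge integral.\<close>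
  have *: "(\<lambda>t. exp (- x * t) * \<psi> t) absolutely_integrable_on {0..}"
    "integral {0..} (\<lambda>t. exp (- x * t) * \<psi> t) = 1 / (x + \<kappa> * sqrt x + 1)" if x: "x > 0" for x
  proof -
    let ?f = "\<lambda>t. exp (- x * t) * \<psi> t"
    have eq: "exp (- complex_of_real x * of_real t) * of_real (\<psi> t) = complex_of_real (?f t)" for t
      by (simp flip: exp_of_real)
    have c: "set_integrable lborel {0..} (\<lambda>t. complex_of_real (?f t))"
      "(LINT t:{0..}|lborel. complex_of_real (?f t)) = 1 / (x + of_real \<kappa> * csqrt (of_real x) + 1)"
      using laplace[unfolded has_laplace_transform_def, rule_format, of "of_real x"] x
      unfolding eq by auto
    have r: "set_integrable lborel {0..} ?f"
      using c(1) unfolding set_integrable_def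
      by (simp add: scaleR_conv_of_real complex_of_real_integrable_eq flip: of_real_mult)
    then show "?f absolutely_integrable_on {0..}"
      unfolding set_integrable_def by (rule integrable_completion[THEN iffD2, rotated]) (use r in \<open>auto simp: set_integrable_def\<close>)
    have "(LINT t:{0..}|lborel. complex_of_real (?f t)) = of_real (LINT t:{0..}|lborel. ?f t)"
      by (rule set_integral_complex_of_real)
    also have "(LINT t:{0..}|lborel. ?f t) = integral {0..} ?f"
      by (rule set_borel_integral_eq_integral(2)[OF r])
    finally have "complex_of_real (integral {0..} ?f) = of_real (1 / (x + \<kappa> * sqrt x + 1))"
      using c(2) x by (simp add: csqrt_of_real_nonneg)
    then show "integral {0..} ?f = 1 / (x + \<kappa> * sqrt x + 1)"
      by (simp only: of_real_eq_iff)
  qed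
  have "((\<lambda>x. x * (1 / (x + \<kappa> * sqrt x + 1))) \<longlongrightarrow> \<psi> 0) at_top"
  proof (rule Lim_transform_eventually)
    show "((\<lambda>x. x * integral {0..} (\<lambda>t. exp (- x * t) * \<psi> t)) \<longlongrightarrow> \<psi> 0) at_top"
      by (rule laplace_initial_value[OF cont *(1)])
    show "eventually (\<lambda>x. x * integral {0..} (\<lambda>t. exp (- x * t) * \<psi> t) = x * (1 / (x + \<kappa> * sqrt x + 1))) at_top"
      using eventually_gt_at_top[of 0] by eventually_elim (simp only: *(2))
  qed
  moreover have "((\<lambda>x. x * (1 / (x + \<kappa> * sqrt x + 1))) \<longlongrightarrow> 1) at_top"
    by real_asymp
  ultimately show ?thesis
    using tendsto_unique by force
qed

section \<open>Mild solutions\<close>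

text \<open>The absolute value extends \<open>\<psi>\<close> continuously to negative arguments.\<close>

definition mild_kernel ::
  "real \<Rightarrow> real \<Rightarrow> (real \<Rightarrow> real) \<Rightarrow> 'n::finite field \<Rightarrow> (real ^ 'n \<Rightarrow> real \<Rightarrow> real ^ 'n ^ 'n) \<Rightarrow>
   'n field \<Rightarrow> real \<Rightarrow> real \<Rightarrow> (real ^ 'n) \<times> (real ^ 'n) \<Rightarrow> (real ^ 'n) \<times> (real ^ 'n)" where
  "mild_kernel \<epsilon> t0 \<psi> A M B t s z =
     (\<epsilon> *\<^sub>R (snd z + A (fst z) (t0 + \<epsilon> * s)),
      \<epsilon> *\<^sub>R \<psi> \<bar>t - s\<bar> *\<^sub>R (- (M (fst z) (t0 + \<epsilon> * s) *v snd z) + B (fst z) (t0 + \<epsilon> * s)))"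

definition mild_forcing ::
  "(real \<Rightarrow> real) \<Rightarrow> real ^ 'n \<Rightarrow> real ^ 'n \<Rightarrow> real \<Rightarrow> (real ^ 'n) \<times> (real ^ 'n)" where
  "mild_forcing \<psi> y0 w0 t = (y0, \<psi> t *\<^sub>R w0)"

section \<open>Growth and Lipschitz estimates for the mild kernel\<close>

context
  fixes \<epsilon> t0 :: real and \<psi> :: "real \<Rightarrow> real"
    and A B :: "'n::finite field" and M :: "real ^ 'n \<Rightarrow> real \<Rightarrow> real ^ 'n ^ 'n"
  assumes \<psi>: "continuous_on {0..} \<psi>"
    and A: "bounded_lipschitz_on UNIV (\<lambda>(x, t). A x t)"
    and M: "bounded_lipschitz_on UNIV (\<lambda>(x, t). M x t)"
    and B: "bounded_lipschitz_on UNIV (\<lambda>(x, t). B x t)"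
begin

lemma continuous_on_mild_kernel:
  "continuous_on UNIV (\<lambda>(t, s, z). mild_kernel \<epsilon> t0 \<psi> A M B t s z)"
proof -
  have *: "continuous_on S (\<lambda>p. F (fst (snd (snd p))) (t0 + \<epsilon> * fst (snd p)))"
    if "bounded_lipschitz_on UNIV (\<lambda>(x, t). F x t)"
    for F :: "real ^ 'n \<Rightarrow> real \<Rightarrow> 'b::real_normed_vector" and S :: "(real \<times> real \<times> (real ^ 'n) \<times> (real ^ 'n)) set"
  proof -
    have "continuous_on S (\<lambda>p. (fst (snd (snd p)), t0 + \<epsilon> * fst (snd p)))"
      by (intro continuous_intros)
    from continuous_on_compose2[OF bounded_lipschitz_on_imp_continuous_on[OF that] this] show ?thesis
      by simp
  qed
  show ?thesis
    unfolding mild_kernel_def case_prod_unfold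
    by (intro continuous_intros * A M B continuous_on_compose2[OF \<psi>]
        bounded_bilinear.continuous_on[OF bounded_bilinear_matrix_vector_mult]) auto
qed

text \<open>Continuity bounds \<psi> on compact intervals, so the kernel constants derived from this
  bound depend on \<open>T\<close>.\<close>

lemma psi_bound:
  obtains C where "C \<ge> 0" "\<And>s t. 0 \<le> s \<Longrightarrow> s \<le> t \<Longrightarrow> t \<le> T \<Longrightarrow> \<bar>\<psi> \<bar>t - s\<bar>\<bar> \<le> C"
proof -
  have "bounded (\<psi> ` {0..T})"
    using \<psi> by (intro compact_imp_bounded compact_continuous_image) (auto intro: continuous_on_subset)
  then obtain C where "\<forall>x\<in>\<psi> ` {0..T}. norm x \<le> C"
    unfolding bounded_iff by blast
  then show thesis
    \<comment> \<open>For \<open>T < 0\<close> the image is empty and \<open>C\<close> could be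
      negative, hence the maximum with 0.\<close>
    by (intro that[of "max C 0"]) (auto simp: le_max_iff_disj)
qed

lemma mild_kernel_norm_le:
  assumes "\<bar>\<psi> \<bar>t - s\<bar>\<bar> \<le> C"
  shows "norm (mild_kernel \<epsilon> t0 \<psi> A M B t s z)
    \<le> \<bar>\<epsilon>\<bar> * norm (snd z + A (fst z) (t0 + \<epsilon> * s)) +
      \<bar>\<epsilon>\<bar> * C * norm (- (M (fst z) (t0 + \<epsilon> * s) *v snd z) + B (fst z) (t0 + \<epsilon> * s))"
    (is "_ \<le> _ + \<bar>\<epsilon>\<bar> * C * norm ?b")
proof -
  have "\<bar>\<epsilon>\<bar> * \<bar>\<psi> \<bar>t - s\<bar>\<bar> * norm ?b \<le> \<bar>\<epsilon>\<bar> * C * norm ?b"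
    using assms by (intro mult_right_mono mult_left_mono) auto
  then show ?thesis
    unfolding mild_kernel_def by (intro order_trans[OF norm_Pair_le]) (simp add: abs_mult mult.assoc)
qed

lemma mild_kernel_growth:
  "\<exists>c. \<forall>t s z. 0 \<le> s \<and> s \<le> t \<and> t \<le> T \<longrightarrow>
    norm (mild_kernel \<epsilon> t0 \<psi> A M B t s z) \<le> c * (1 + norm z)"
proof -
  obtain C where C: "C \<ge> 0" "\<And>s t. 0 \<le> s \<Longrightarrow> s \<le> t \<Longrightarrow> t \<le> T \<Longrightarrow> \<bar>\<psi> \<bar>t - s\<bar>\<bar> \<le> C"
    using psi_bound by blast
  obtain a where a: "a \<ge> 0" "\<And>x t. norm (A x t) \<le> a"
    using bounded_lipschitz_onE[OF A] by (metis UNIV_I case_prod_conv)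
  obtain m where m: "m \<ge> 0" "\<And>x t. norm (M x t) \<le> m"
    using bounded_lipschitz_onE[OF M] by (metis UNIV_I case_prod_conv)
  obtain b where b: "b \<ge> 0" "\<And>x t. norm (B x t) \<le> b"
    using bounded_lipschitz_onE[OF B] by (metis UNIV_I case_prod_conv)
  \<comment> \<open>The norm of the matrix type is the Euclidean norm of all entries, not the
    operator norm; \<open>K\<close> is any constant for the matrix-vector product in it.\<close>
  obtain K where K: "K \<ge> 0" "\<And>(X :: real^'n^'n) v. norm (X *v v) \<le> norm X * norm v * K"
    using bounded_bilinear.nonneg_bounded[OF bounded_bilinear_matrix_vector_mult] by metis
  have "norm (mild_kernel \<epsilon> t0 \<psi> A M B t s z)
      \<le> (\<bar>\<epsilon>\<bar> * (1 + a) + \<bar>\<epsilon>\<bar> * C * (m * K + b)) * (1 + norm z)"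
    if st: "0 \<le> s" "s \<le> t" "t \<le> T" for t s z
  proof -
    let ?\<tau> = "t0 + \<epsilon> * s"
    have z: "norm (snd z) \<le> norm z"
      by (metis norm_snd_le prod.collapse)
    have "norm (snd z + A (fst z) ?\<tau>) \<le> norm z + a"
      by (intro norm_triangle_le add_mono z a)
    also have "\<dots> \<le> (1 + a) * (1 + norm z)"
      using a(1) by (simp add: algebra_simps)
    finally have 1: "norm (snd z + A (fst z) ?\<tau>) \<le> (1 + a) * (1 + norm z)" .
    have "norm (M (fst z) ?\<tau> *v snd z) \<le> m * norm z * K"
      using m z K(1) by (intro order_trans[OF K(2)] mult_right_mono mult_mono) auto
    then have "norm (- (M (fst z) ?\<tau> *v snd z) + B (fst z) ?\<tau>) \<le> m * norm z * K + b"
      by (intro norm_triangle_le add_mono b) simp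
    also have "\<dots> \<le> (m * K + b) * (1 + norm z)"
      using m(1) b(1) K(1) by (simp add: algebra_simps)
    finally have 2: "norm (- (M (fst z) ?\<tau> *v snd z) + B (fst z) ?\<tau>) \<le> (m * K + b) * (1 + norm z)" .
    have "norm (mild_kernel \<epsilon> t0 \<psi> A M B t s z)
        \<le> \<bar>\<epsilon>\<bar> * ((1 + a) * (1 + norm z)) + \<bar>\<epsilon>\<bar> * C * ((m * K + b) * (1 + norm z))"
      using C(1) by (intro order_trans[OF mild_kernel_norm_le[OF C(2)[OF st]]] add_mono mult_left_mono 1 2) auto
    then show ?thesis
      by (simp add: algebra_simps)
  qed
  then show ?thesis
    by blast
qed

text \<open>On a ball the variable w is itself bounded and Lipschitz, so the product rule applies to
  M w. Time is carried as a coordinate, which allows composition with an affine map; at equal times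
  the distance reduces to that of the states.\<close>

lemma mild_kernel_lipschitz:
  "\<exists>L. \<forall>t s. \<forall>x\<in>cball 0 r. \<forall>y\<in>cball 0 r. 0 \<le> s \<and> s \<le> t \<and> t \<le> T \<longrightarrow>
    norm (mild_kernel \<epsilon> t0 \<psi> A M B t s x - mild_kernel \<epsilon> t0 \<psi> A M B t s y) \<le> L * norm (x - y)"
proof -
  obtain C where C: "C \<ge> 0" "\<And>s t. 0 \<le> s \<Longrightarrow> s \<le> t \<Longrightarrow> t \<le> T \<Longrightarrow> \<bar>\<psi> \<bar>t - s\<bar>\<bar> \<le> C"
    using psi_bound by blast
  let ?S = "UNIV \<times> cball 0 r :: (real \<times> (real ^ 'n) \<times> (real ^ 'n)) set"
  let ?P = "\<lambda>p. snd (snd p) + A (fst (snd p)) (t0 + \<epsilon> * fst p)"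
  let ?Q = "\<lambda>p. B (fst (snd p)) (t0 + \<epsilon> * fst p) - M (fst (snd p)) (t0 + \<epsilon> * fst p) *v snd (snd p)"
  have lip: "bounded_lipschitz_on ?S (\<lambda>p. F (fst (snd p)) (t0 + \<epsilon> * fst p))"
    if F: "bounded_lipschitz_on UNIV (\<lambda>(x, t). F x t)"
    for F :: "real ^ 'n \<Rightarrow> real \<Rightarrow> 'b::real_normed_vector"
  proof -
    have "bounded_linear (\<lambda>p :: real \<times> (real ^ 'n) \<times> (real ^ 'n). (fst (snd p), \<epsilon> * fst p))"
      by (intro bounded_linear_Pair bounded_linear_compose[OF bounded_linear_fst]
          bounded_linear_compose[OF bounded_linear_mult_right] bounded_linear_snd bounded_linear_fst)
    then obtain K where "K-lipschitz_on UNIV (\<lambda>p :: real \<times> (real ^ 'n) \<times> (real ^ 'n). (fst (snd p), \<epsilon> * fst p))"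
      by (rule bounded_linear.lipschitz_boundE)
    then have "K-lipschitz_on ?S (\<lambda>p. (fst (snd p), t0 + \<epsilon> * fst p))"
      by (auto simp: lipschitz_on_def dist_Pair_Pair)
    from bounded_lipschitz_on_compose_lipschitz[OF F this] show ?thesis
      by simp
  qed
  have w: "bounded_lipschitz_on ?S (\<lambda>p. snd (snd p))"
  proof (rule bounded_lipschitz_onI)
    show "norm (snd (snd p)) \<le> r" if "p \<in> ?S" for p
      using that norm_snd_le[of "snd (snd p)" "fst (snd p)"] by auto
    show "dist (snd (snd p)) (snd (snd q)) \<le> 1 * dist p q" for p q :: "real \<times> (real ^ 'n) \<times> (real ^ 'n)"
      using order_trans[OF dist_snd_le dist_snd_le] by simp
  qed
  obtain LP where LP: "LP \<ge> 0" "\<And>p q. p \<in> ?S \<Longrightarrow> q \<in> ?S \<Longrightarrow> dist (?P p) (?P q) \<le> LP * dist p q"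
    using bounded_lipschitz_onE[OF bounded_lipschitz_on_add[OF w lip[OF A]]] by metis
  obtain LQ where LQ: "LQ \<ge> 0" "\<And>p q. p \<in> ?S \<Longrightarrow> q \<in> ?S \<Longrightarrow> dist (?Q p) (?Q q) \<le> LQ * dist p q"
    using bounded_lipschitz_onE[OF bounded_lipschitz_on_diff[OF lip[OF B]
        bounded_lipschitz_on_bilinear[OF bounded_bilinear_matrix_vector_mult lip[OF M] w]]] by metis
  have "norm (mild_kernel \<epsilon> t0 \<psi> A M B t s x - mild_kernel \<epsilon> t0 \<psi> A M B t s y)
      \<le> (\<bar>\<epsilon>\<bar> * LP + \<bar>\<epsilon>\<bar> * C * LQ) * norm (x - y)"
    if x: "x \<in> cball 0 r" and y: "y \<in> cball 0 r" and st: "0 \<le> s" "s \<le> t" "t \<le> T" for t s x y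
  proof -
    have eq: "mild_kernel \<epsilon> t0 \<psi> A M B t s x - mild_kernel \<epsilon> t0 \<psi> A M B t s y =
        (\<epsilon> *\<^sub>R (?P (s, x) - ?P (s, y)), (\<epsilon> * \<psi> \<bar>t - s\<bar>) *\<^sub>R (?Q (s, x) - ?Q (s, y)))"
      by (simp add: mild_kernel_def scaleR_diff_right)
    have 1: "norm (?P (s, x) - ?P (s, y)) \<le> LP * norm (x - y)"
      using LP(2)[of "(s, x)" "(s, y)"] x y by (simp add: dist_norm[symmetric] dist_Pair_Pair)
    have 2: "norm (?Q (s, x) - ?Q (s, y)) \<le> LQ * norm (x - y)"
      using LQ(2)[of "(s, x)" "(s, y)"] x y by (simp add: dist_norm[symmetric] dist_Pair_Pair)
    have "norm (mild_kernel \<epsilon> t0 \<psi> A M B t s x - mild_kernel \<epsilon> t0 \<psi> A M B t s y)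
        \<le> \<bar>\<epsilon>\<bar> * norm (?P (s, x) - ?P (s, y)) + \<bar>\<epsilon>\<bar> * \<bar>\<psi> \<bar>t - s\<bar>\<bar> * norm (?Q (s, x) - ?Q (s, y))"
      unfolding eq by (rule order_trans[OF norm_Pair_le]) (simp only: norm_scaleR abs_mult)
    also have "\<dots> \<le> \<bar>\<epsilon>\<bar> * (LP * norm (x - y)) + \<bar>\<epsilon>\<bar> * C * (LQ * norm (x - y))"
      using C(1) C(2)[OF st] by (intro add_mono mult_mono 1 2) auto
    finally show ?thesis
      by (simp add: algebra_simps)
  qed
  then show ?thesis
    by blast
qed

text \<open>Integration commutes with the two projections, since the kernel along a continuous curve
  is integrable. The initial conditions follow from the equation at t = 0, where the integral
  vanishes and \<open>\<psi> 0 = 1\<close>.\<close>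

lemma mild_equations_iff_volterra_solution:
  assumes "\<psi> 0 = 1" "0 \<le> T"
  shows "mild_equations {0..T} \<epsilon> t0 \<psi> A M B y0 w0 y w \<longleftrightarrow>
    volterra_solution T (mild_forcing \<psi> y0 w0) (mild_kernel \<epsilon> t0 \<psi> A M B) (\<lambda>t. (y t, w t))"
proof (cases "continuous_on {0..T} (\<lambda>t. (y t, w t))")
  case True
  have int: "integral {0..t} (\<lambda>s. mild_kernel \<epsilon> t0 \<psi> A M B t s (y s, w s)) =
      (\<epsilon> *\<^sub>R integral {0..t} (\<lambda>s. w s + A (y s) (t0 + \<epsilon> * s)),
       \<epsilon> *\<^sub>R integral {0..t}
         (\<lambda>s. \<psi> (t - s) *\<^sub>R (- (M (y s) (t0 + \<epsilon> * s) *v w s) + B (y s) (t0 + \<epsilon> * s))))"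
    if t: "t \<in> {0..T}" for t
  proof -
    let ?k = "\<lambda>s. mild_kernel \<epsilon> t0 \<psi> A M B t s (y s, w s)"
    have "continuous_on {0..t} (\<lambda>t. (y t, w t))"
      using True by (rule continuous_on_subset) (use t in auto)
    then have "continuous_on {0..t} (\<lambda>s. (t, s, y s, w s))"
      by (intro continuous_on_Pair[of _ "\<lambda>s. t"] continuous_on_Pair[of _ "\<lambda>s. s"]
          continuous_on_const continuous_on_id)
    from continuous_on_compose2[OF continuous_on_mild_kernel this] have "continuous_on {0..t} ?k"
      by simp
    then have k: "?k integrable_on {0..t}"
      by (rule integrable_continuous_interval)
    have "fst (integral {0..t} ?k) = integral {0..t} (\<lambda>s. \<epsilon> *\<^sub>R (w s + A (y s) (t0 + \<epsilon> * s)))"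
      using integral_linear[OF k bounded_linear_fst] by (simp add: o_def mild_kernel_def)
    also have "\<dots> = \<epsilon> *\<^sub>R integral {0..t} (\<lambda>s. w s + A (y s) (t0 + \<epsilon> * s))"
      by (rule integral_cmul)
    finally have fst: "fst (integral {0..t} ?k) = \<dots>" .
    have "snd (integral {0..t} ?k) = integral {0..t} (\<lambda>s. snd (?k s))"
      using integral_linear[OF k bounded_linear_snd] by (simp add: o_def)
    also have "\<dots> = integral {0..t}
         (\<lambda>s. \<epsilon> *\<^sub>R \<psi> (t - s) *\<^sub>R (- (M (y s) (t0 + \<epsilon> * s) *v w s) + B (y s) (t0 + \<epsilon> * s)))"
      by (rule integral_cong) (simp add: mild_kernel_def)
    also have "\<dots> = \<epsilon> *\<^sub>R integral {0..t}
         (\<lambda>s. \<psi> (t - s) *\<^sub>R (- (M (y s) (t0 + \<epsilon> * s) *v w s) + B (y s) (t0 + \<epsilon> * s)))"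
      by (rule integral_cmul)
    finally show ?thesis
      by (intro prod_eqI) (simp_all only: fst_conv snd_conv fst)
  qed
  have "y 0 = y0 \<and> w 0 = w0"
    if "\<forall>t\<in>{0..T}. (y t, w t) = mild_forcing \<psi> y0 w0 t +
      integral {0..t} (\<lambda>s. mild_kernel \<epsilon> t0 \<psi> A M B t s (y s, w s))"
    using bspec[OF that, of 0] assms by (simp add: mild_forcing_def zero_prod_def)
  then show ?thesis
    using True int by (auto simp: mild_equations_def volterra_solution_def mild_forcing_def)
qed (auto simp: mild_equations_def volterra_solution_def)

end

text \<open>The fields need not agree at the end point \<open>T\<close>, which does not affect the integrals.\<close>

lemma mild_equations_cong:
  assumes "\<And>s. s \<in> {0..<T} \<Longrightarrow> A (y s) (t0 + \<epsilon> * s) = A' (y s) (t0 + \<epsilon> * s)"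
    and "\<And>s. s \<in> {0..<T} \<Longrightarrow> M (y s) (t0 + \<epsilon> * s) = M' (y s) (t0 + \<epsilon> * s)"
    and "\<And>s. s \<in> {0..<T} \<Longrightarrow> B (y s) (t0 + \<epsilon> * s) = B' (y s) (t0 + \<epsilon> * s)"
  shows "mild_equations {0..T} \<epsilon> t0 \<psi> A M B y0 w0 y w \<longleftrightarrow>
    mild_equations {0..T} \<epsilon> t0 \<psi> A' M' B' y0 w0 y w"
proof -
  have "integral {0..t} f = integral {0..t} f'"
    if "t \<in> {0..T}" "\<And>s. s \<in> {0..<T} \<Longrightarrow> f s = f' s" for t and f f' :: "real \<Rightarrow> real ^ 'n"
    by (rule integral_spike[OF negligible_sing[of T]]) (use that in auto)
  note spike = this
  have "integral {0..t} (\<lambda>s. w s + A (y s) (t0 + \<epsilon> * s)) =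
      integral {0..t} (\<lambda>s. w s + A' (y s) (t0 + \<epsilon> * s))"
    "integral {0..t} (\<lambda>s. \<psi> (t - s) *\<^sub>R (- (M (y s) (t0 + \<epsilon> * s) *v w s) + B (y s) (t0 + \<epsilon> * s))) =
      integral {0..t} (\<lambda>s. \<psi> (t - s) *\<^sub>R (- (M' (y s) (t0 + \<epsilon> * s) *v w s) + B' (y s) (t0 + \<epsilon> * s)))"
    if "t \<in> {0..T}" for t
    by (rule spike[OF that]; simp add: assms)+
  then show ?thesis
    unfolding mild_equations_def by simp
qed

section \<open>Global solutions that stay in the domain\<close>

lemma mild_equations_atLeast_iff:
  "mild_equations {0..} \<epsilon> t0 \<psi> A M B y0 w0 y w \<longleftrightarrow>
    continuous_on {0..} (\<lambda>t. (y t, w t)) \<and> (\<forall>T\<ge>0. mild_equations {0..T} \<epsilon> t0 \<psi> A M B y0 w0 y w)"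
proof
  assume *: "mild_equations {0..} \<epsilon> t0 \<psi> A M B y0 w0 y w"
  then have c: "continuous_on {0..} (\<lambda>t. (y t, w t))"
    by (simp add: mild_equations_def)
  have "continuous_on {0..T} (\<lambda>t. (y t, w t))" for T
    by (rule continuous_on_subset[OF c]) auto
  then show "continuous_on {0..} (\<lambda>t. (y t, w t)) \<and>
      (\<forall>T\<ge>0. mild_equations {0..T} \<epsilon> t0 \<psi> A M B y0 w0 y w)"
    using * by (simp add: mild_equations_def)
next
  assume *: "continuous_on {0..} (\<lambda>t. (y t, w t)) \<and>
    (\<forall>T\<ge>0. mild_equations {0..T} \<epsilon> t0 \<psi> A M B y0 w0 y w)"
  show "mild_equations {0..} \<epsilon> t0 \<psi> A M B y0 w0 y w"
    unfolding mild_equations_def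
  proof (intro conjI ballI)
    show "y 0 = y0" "w 0 = w0"
      using *[THEN conjunct2, rule_format, of 0] by (auto simp: mild_equations_def)
    fix \<tau> :: real assume "\<tau> \<in> {0..}"
    then have "mild_equations {0..\<tau>} \<epsilon> t0 \<psi> A M B y0 w0 y w" "\<tau> \<in> {0..\<tau>}"
      using * by auto
    then show "y \<tau> = y0 + \<epsilon> *\<^sub>R integral {0..\<tau>} (\<lambda>s. w s + A (y s) (t0 + \<epsilon> * s))"
      "w \<tau> = \<psi> \<tau> *\<^sub>R w0 + \<epsilon> *\<^sub>R integral {0..\<tau>}
          (\<lambda>s. \<psi> (\<tau> - s) *\<^sub>R (- (M (y s) (t0 + \<epsilon> * s) *v w s) + B (y s) (t0 + \<epsilon> * s)))"
      unfolding mild_equations_def by blast+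
  qed (use * in auto)
qed

lemma global_mild_solution_ex1:
  fixes A0 B0 :: "'n::finite field"
  assumes D: "open D" and t0: "0 \<le> t0" and \<epsilon>: "0 \<le> \<epsilon>"
    and \<psi>: "continuous_on {0..} \<psi>" "\<psi> 0 = 1"
    and A0: "bounded_lipschitz_on (D \<times> {0..}) (\<lambda>(x, t). A0 x t)"
    and M0: "bounded_lipschitz_on (D \<times> {0..}) (\<lambda>(x, t). M0 x t)"
    and B0: "bounded_lipschitz_on (D \<times> {0..}) (\<lambda>(x, t). B0 x t)"
    and no_exit: "no_exit D \<epsilon> t0 \<psi> A0 M0 B0 y0 w0"
  shows "\<exists>y w. global_mild_solution D \<epsilon> t0 \<psi> A0 M0 B0 y0 w0 y w \<and>
    (\<forall>y' w'. global_mild_solution D \<epsilon> t0 \<psi> A0 M0 B0 y0 w0 y' w' \<longrightarrow>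
      (\<forall>\<tau>\<ge>0. y' \<tau> = y \<tau> \<and> w' \<tau> = w \<tau>))"
proof -
  obtain A where A: "bounded_lipschitz_on UNIV (\<lambda>(x, t). A x t)"
    and A_eq: "\<And>x t. x \<in> D \<Longrightarrow> 0 \<le> t \<Longrightarrow> A x t = A0 x t"
    using bounded_lipschitz_field_extension[OF A0] by metis
  obtain M where M: "bounded_lipschitz_on UNIV (\<lambda>(x, t). M x t)"
    and M_eq: "\<And>x t. x \<in> D \<Longrightarrow> 0 \<le> t \<Longrightarrow> M x t = M0 x t"
    using bounded_lipschitz_field_extension[OF M0] by metis
  obtain B where B: "bounded_lipschitz_on UNIV (\<lambda>(x, t). B x t)"
    and B_eq: "\<And>x t. x \<in> D \<Longrightarrow> 0 \<le> t \<Longrightarrow> B x t = B0 x t"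
    using bounded_lipschitz_field_extension[OF B0] by metis
  let ?h = "mild_forcing \<psi> y0 w0"
  let ?G = "mild_kernel \<epsilon> t0 \<psi> A M B"
  have h: "continuous_on {0..} ?h"
    unfolding mild_forcing_def by (intro continuous_intros \<psi>)
  note G = continuous_on_mild_kernel[OF \<psi>(1) A M B] mild_kernel_growth[OF \<psi>(1) A M B]
    mild_kernel_lipschitz[OF \<psi>(1) A M B]
  note iff = mild_equations_iff_volterra_solution[OF \<psi>(1) A M B \<psi>(2)]
  \<comment> \<open>The half-open interval matters: at a first exit time \<open>T\<close> the
    position \<open>y T\<close> is outside \<open>D\<close>, yet the two systems must still be
    equivalent on [0, T].\<close>
  have extended_iff: "mild_equations {0..T} \<epsilon> t0 \<psi> A0 M0 B0 y0 w0 y w \<longleftrightarrow>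
      mild_equations {0..T} \<epsilon> t0 \<psi> A M B y0 w0 y w"
    if "\<And>s. s \<in> {0..<T} \<Longrightarrow> y s \<in> D" for T y w
    by (rule mild_equations_cong) (use that t0 \<epsilon> A_eq M_eq B_eq in simp_all)
  obtain z where z: "continuous_on {0..} z" "\<And>T. volterra_solution T ?h ?G z"
    using volterra_ex_global[OF h G] by blast
  define y where "y t = fst (z t)" for t
  define w where "w t = snd (z t)" for t
  have z_eq: "z = (\<lambda>t. (y t, w t))"
    by (simp add: y_def w_def)
  have sol: "mild_equations {0..T} \<epsilon> t0 \<psi> A M B y0 w0 y w" if "0 \<le> T" for T
    using z(2)[of T] iff[OF that] by (simp add: z_eq)
  have y_in: "y t \<in> D" if "0 \<le> t" for t
  proof (rule ccontr)
    assume "y t \<notin> D"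
    \<comment> \<open>\<open>S\<close> is the set of times spent outside \<open>D\<close>. It is
      closed because \<open>D\<close> is open, so its infimum is attained and is the first exit
      time. For \<open>y0\<close> outside \<open>D\<close> it is 0, which is the case
      \<open>T = 0\<close> of the no-exit condition.\<close>
    define S where "S = {0..} \<inter> y -` (- D)"
    have "continuous_on {0..} y"
      using z(1) unfolding y_def by (intro continuous_intros)
    then have "closed S"
      unfolding S_def using D by (intro continuous_closed_preimage) auto
    moreover have "S \<noteq> {}" "bdd_below S"
      using \<open>y t \<notin> D\<close> that by (auto simp: S_def)
    ultimately have Inf: "Inf S \<in> S"
      by (intro closed_contains_Inf)
    then have Inf_ge: "0 \<le> Inf S"
      by (simp add: S_def)
    have in_D: "y s \<in> D" if "s \<in> {0..<Inf S}" for s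
      using that cInf_lower[OF _ \<open>bdd_below S\<close>, of s] by (force simp: S_def)
    have "mild_equations {0..Inf S} \<epsilon> t0 \<psi> A0 M0 B0 y0 w0 y w"
      using sol[OF Inf_ge] extended_iff[of "Inf S" y w] in_D by blast
    then have "y (Inf S) \<in> D"
      using no_exit in_D Inf_ge unfolding no_exit_def by blast
    then show False
      using Inf by (simp add: S_def)
  qed
  have "global_mild_solution D \<epsilon> t0 \<psi> A0 M0 B0 y0 w0 y w"
    using y_in sol extended_iff z(1) unfolding global_mild_solution_def mild_equations_atLeast_iff z_eq
    by auto
  moreover have "y' t = y t \<and> w' t = w t"
    if sol': "global_mild_solution D \<epsilon> t0 \<psi> A0 M0 B0 y0 w0 y' w'" and t: "0 \<le> t" for y' w' t
  proof -
    \<comment> \<open>A competing solution stays in \<open>D\<close> by definition, so it also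
      solves the extended equations, where uniqueness is known.\<close>
    have "mild_equations {0..t} \<epsilon> t0 \<psi> A M B y0 w0 y' w'"
      using sol' t extended_iff[of t y' w'] unfolding global_mild_solution_def mild_equations_atLeast_iff
      by auto
    then have "volterra_solution t ?h ?G (\<lambda>t. (y' t, w' t))"
      using iff[OF t] by simp
    then have "(y' t, w' t) = z t"
      using t z(2) continuous_on_subset[OF h, of "{0..t}"]
      by (intro volterra_ex1_interval(2)[OF t _ G]) auto
    then show ?thesis
      by (metis fst_conv snd_conv y_def w_def)
  qed
  ultimately show ?thesis
    by blast
qed

theorem theorem4:
  fixes D :: "(real ^ 'n::finite) set"
    and u :: "real ^ 'n \<Rightarrow> real \<Rightarrow> real ^ 'n"
    and g :: "real ^ 'n"
    and \<rho>\<^sub>f \<rho>\<^sub>p Rey R \<kappa> \<gamma> \<epsilon> t0 L\<^sub>M :: real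
    and \<psi> :: "real \<Rightarrow> real"
  assumes dim: "CARD('n) \<in> {2, 3}"
    and dom: "open D"
    and t0: "t0 \<ge> 0"
    and densities: "\<rho>\<^sub>f > 0" "\<rho>\<^sub>p > 0"
    and reynolds: "Rey > 0"
    and eps: "\<epsilon> > 0"
    and R: "R = 2 * \<rho>\<^sub>f / (\<rho>\<^sub>f + 2 * \<rho>\<^sub>p)"
    and kappa: "\<kappa> = sqrt (9 * R / 2)"
    and gamma: "\<gamma> = 9 * R / (2 * Rey)"
    and psi_cont: "continuous_on {0..} \<psi>"
    and psi_laplace: "has_laplace_transform \<psi> (\<lambda>s. 1 / (s + of_real \<kappa> * csqrt s + 1))"
    and regular: "regular_velocity D u"
    and L\<^sub>M: "L\<^sub>M > 0" "sup_onorm D (M_field \<gamma> \<epsilon> u) \<le> ereal L\<^sub>M"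
    and eps_small: "\<epsilon> < 1 / L\<^sub>M"
  shows "\<forall>y0 w0.
    no_exit D \<epsilon> t0 \<psi> (A_field \<gamma> \<epsilon> u) (M_field \<gamma> \<epsilon> u) (B_field R \<gamma> \<epsilon> g u) y0 w0 \<longrightarrow>
    (\<exists>y w.
      global_mild_solution D \<epsilon> t0 \<psi>
        (A_field \<gamma> \<epsilon> u) (M_field \<gamma> \<epsilon> u) (B_field R \<gamma> \<epsilon> g u) y0 w0 y w \<and>
      (\<forall>y' w'.
        global_mild_solution D \<epsilon> t0 \<psi>
          (A_field \<gamma> \<epsilon> u) (M_field \<gamma> \<epsilon> u) (B_field R \<gamma> \<epsilon> g u) y0 w0 y' w' \<longrightarrow>
        (\<forall>\<tau>\<ge>0. y' \<tau> = y \<tau> \<and> w' \<tau> = w \<tau>)))"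
proof -
  have "\<psi> 0 = 1"
    using psi_cont psi_laplace by (rule psi_0_eq_1)
  then show ?thesis
    using global_mild_solution_ex1[OF dom t0 less_imp_le[OF eps] psi_cont _
        regular_velocity_fields[OF regular]] by blast
qed

end
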